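(* Let $F_1$ and $F_2$ be two algebraically closed fields containing a field $K$. Suppose that $A$ and $B$ are two $K$-algebras of the same (possibly infinite) dimension $\omega$ and that the cardinal of $K$ is strictly greater than $\omega$. Then $A_{F_1}$ and $B_{F_1}$ are isomorphic as $F_1$-algebras if and only if $A_{F_2}$ and $B_{F_2}$ are isomorphic as $F_2$-algebras.
   Context: Algebras are not necessarily associative, commutative or unital. Dimension means the cardinality of a $K$-vector space basis. For a $K$-algebra $A$ and a field extension $K\subseteq F$, $A_F:=A\otimes_K F$, regarded as an $F$-algebra. *)

theory Defs
  imports
    "HOL-Computational_Algebra.Polynomial"
    "HOL-Library.Poly_Mapping"
begin

unbundle cardinal_syntax

text \<open>
  A field \<^term>\<open>K\<close> is a whole type of class \<^class>\<open>field\<close>, and a \<^term>\<open>K\<close>-algebra lives on a whole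
  type. It need not be associative, commutative or unital: the only requirement on the
  multiplication is bilinearity.
\<close>

locale nonassoc_algebra = vector_space scale
  for scale :: "'k::field \<Rightarrow> 'a::ab_group_add \<Rightarrow> 'a" +
  fixes mul :: "'a \<Rightarrow> 'a \<Rightarrow> 'a"
  assumes mult_add_left: "mul (x + y) z = mul x z + mul y z"
    and mult_add_right: "mul x (y + z) = mul x y + mul x z"
    and mult_scale_left: "mul (scale c x) y = scale c (mul x y)"
    and mult_scale_right: "mul x (scale c y) = scale c (mul x y)"

text \<open>
  Cardinals are represented by well-order relations as in \<^theory>\<open>HOL.BNF_Cardinal_Order_Relation\<close>;
  the constant \<open>dim\<close> of \<^locale>\<open>vector_space\<close> is not usable here, being \<open>0\<close> on
  every infinite-dimensional space.
\<close>

definition has_dimension :: "('k::field \<Rightarrow> 'a::ab_group_add \<Rightarrow> 'a) \<Rightarrow> 'w rel \<Rightarrow> bool" where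
  "has_dimension scale \<omega> \<longleftrightarrow>
     (\<exists>B. \<not> module.dependent scale B \<and> module.span scale B = UNIV \<and> |B| =o \<omega>)"

definition field_embedding :: "('k::field \<Rightarrow> 'f::field) \<Rightarrow> bool" where
  "field_embedding i \<longleftrightarrow>
     i 1 = 1 \<and> (\<forall>x y. i (x + y) = i x + i y) \<and> (\<forall>x y. i (x * y) = i x * i y)"


text \<open>
  The tensor product of \<^term>\<open>V\<close> and \<^term>\<open>W\<close> over \<^term>\<open>K\<close> is the quotient of the free abelian
  group on \<open>V \<times> W\<close>, i.e. of the type \<open>('v \<times> 'w) \<Rightarrow>\<^sub>0 int\<close>, by the subgroup generated by the
  usual relators. The latter depends on the scalar multiplications, so the quotient is formed as a
  set of cosets and not as a type.
\<close>

inductive_set tensor_relations ::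
  "('k \<Rightarrow> 'v::ab_group_add \<Rightarrow> 'v) \<Rightarrow> ('k \<Rightarrow> 'w::ab_group_add \<Rightarrow> 'w) \<Rightarrow> (('v \<times> 'w) \<Rightarrow>\<^sub>0 int) set"
  for sv sw where
  add_left: "frag_of (x + y, w) - frag_of (x, w) - frag_of (y, w) \<in> tensor_relations sv sw"
| add_right: "frag_of (x, v + w) - frag_of (x, v) - frag_of (x, w) \<in> tensor_relations sv sw"
| balanced: "frag_of (sv c x, w) - frag_of (x, sw c w) \<in> tensor_relations sv sw"
| diff: "p \<in> tensor_relations sv sw \<Longrightarrow> q \<in> tensor_relations sv sw \<Longrightarrow>
    p - q \<in> tensor_relations sv sw"

definition tensor_equiv ::
  "('k \<Rightarrow> 'v::ab_group_add \<Rightarrow> 'v) \<Rightarrow> ('k \<Rightarrow> 'w::ab_group_add \<Rightarrow> 'w) \<Rightarrow> (('v \<times> 'w) \<Rightarrow>\<^sub>0 int) rel" where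
  "tensor_equiv sv sw = {(p, q). p - q \<in> tensor_relations sv sw}"

text \<open>
  On the free abelian group, the bilinear extension of \<open>(a, f) (b, g) = (a b, f g)\<close> and the
  additive extension of \<open>g (a, f) = (a, g f)\<close>.
\<close>

definition free_mult ::
  "('a \<Rightarrow> 'a \<Rightarrow> 'a) \<Rightarrow> (('a \<times> 'f::field) \<Rightarrow>\<^sub>0 int) \<Rightarrow> (('a \<times> 'f) \<Rightarrow>\<^sub>0 int) \<Rightarrow> (('a \<times> 'f) \<Rightarrow>\<^sub>0 int)" where
  "free_mult mul p q =
     frag_extend (\<lambda>(a, f). frag_extend (\<lambda>(b, g). frag_of (mul a b, f * g)) q) p"

definition free_scale :: "'f::field \<Rightarrow> (('a \<times> 'f) \<Rightarrow>\<^sub>0 int) \<Rightarrow> (('a \<times> 'f) \<Rightarrow>\<^sub>0 int)" where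
  "free_scale g = frag_extend (\<lambda>(a, f). frag_of (a, g * f))"


record ('f, 't) algebra_structure =
  alg_carrier :: "'t set"
  alg_add :: "'t \<Rightarrow> 't \<Rightarrow> 't"
  alg_scale :: "'f \<Rightarrow> 't \<Rightarrow> 't"
  alg_mult :: "'t \<Rightarrow> 't \<Rightarrow> 't"

definition algebra_isomorphic ::
  "('f, 's) algebra_structure \<Rightarrow> ('f, 't) algebra_structure \<Rightarrow> bool" where
  "algebra_isomorphic S T \<longleftrightarrow>
     (\<exists>h. bij_betw h (alg_carrier S) (alg_carrier T) \<and>
        (\<forall>x\<in>alg_carrier S. \<forall>y\<in>alg_carrier S. h (alg_add S x y) = alg_add T (h x) (h y)) \<and>
        (\<forall>c. \<forall>x\<in>alg_carrier S. h (alg_scale S c x) = alg_scale T c (h x)) \<and>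
        (\<forall>x\<in>alg_carrier S. \<forall>y\<in>alg_carrier S. h (alg_mult S x y) = alg_mult T (h x) (h y)))"

text \<open>
  The algebra \<open>A\<^sub>F\<close>, where \<^term>\<open>F\<close> is a \<^term>\<open>K\<close>-vector space via the embedding \<^term>\<open>i\<close>. Each union
  below runs over the representatives of the given classes; all its members coincide (see
  \<open>base_change_add\<close>, \<open>base_change_scale\<close> and \<open>base_change_mult\<close>).
\<close>

definition base_change ::
  "('k::field \<Rightarrow> 'a::ab_group_add \<Rightarrow> 'a) \<Rightarrow> ('a \<Rightarrow> 'a \<Rightarrow> 'a) \<Rightarrow> ('k \<Rightarrow> 'f::field) \<Rightarrow>
     ('f, (('a \<times> 'f) \<Rightarrow>\<^sub>0 int) set) algebra_structure" where
  "base_change scale mul i =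
     (let r = tensor_equiv scale (\<lambda>c f. i c * f) in
      \<lparr> alg_carrier = UNIV // r,
        alg_add = (\<lambda>X Y. \<Union>p\<in>X. \<Union>q\<in>Y. r `` {p + q}),
        alg_scale = (\<lambda>g X. \<Union>p\<in>X. r `` {free_scale g p}),
        alg_mult = (\<lambda>X Y. \<Union>p\<in>X. \<Union>q\<in>Y. r `` {free_mult mul p q}) \<rparr>)"


lemma tensor_relations_zero: "0 \<in> tensor_relations sv sw"
  using tensor_relations.diff[OF tensor_relations.add_left[of 0 0 0] tensor_relations.add_left[of 0 0 0]]
  by simp

lemma tensor_relations_uminus:
  "p \<in> tensor_relations sv sw \<Longrightarrow> - p \<in> tensor_relations sv sw"
  using tensor_relations.diff[OF tensor_relations_zero] by fastforce

lemma tensor_relations_add: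
  "p \<in> tensor_relations sv sw \<Longrightarrow> q \<in> tensor_relations sv sw \<Longrightarrow> p + q \<in> tensor_relations sv sw"
  using tensor_relations.diff[OF _ tensor_relations_uminus] by fastforce

lemma equiv_tensor_equiv: "equiv UNIV (tensor_equiv sv sw)"
proof (rule equivI)
  show "tensor_equiv sv sw \<subseteq> UNIV \<times> UNIV" by simp
  show "refl_on UNIV (tensor_equiv sv sw)"
    by (auto simp: refl_on_def tensor_equiv_def tensor_relations_zero)
  show "sym (tensor_equiv sv sw)"
    unfolding sym_def tensor_equiv_def using tensor_relations_uminus by fastforce
  show "trans (tensor_equiv sv sw)"
    unfolding trans_def tensor_equiv_def using tensor_relations_add by fastforce
qed

lemma tensor_relations_scale:
  assumes "p \<in> tensor_relations scale (\<lambda>c f. i c * f)"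
  shows "free_scale g p \<in> tensor_relations scale (\<lambda>c f. i c * (f :: 'f::field))"
  using assms
proof induction
  case (balanced c x w)
  show ?case
    using tensor_relations.balanced[of scale c x "g * w" "\<lambda>c f. i c * f"]
    by (simp add: free_scale_def frag_extend_diff mult.left_commute)
qed (auto simp: free_scale_def frag_extend_diff distrib_left
       intro: tensor_relations.intros)

lemma free_mult_diff_left: "free_mult m (p - p') q = free_mult m p q - free_mult m p' q"
  by (simp add: free_mult_def frag_extend_diff)

lemma frag_cmul_diff_distrib2: "frag_cmul c (x - y) = frag_cmul c x - frag_cmul c y"
  using frag_cmul_distrib2[of c "x - y" y] by (simp add: algebra_simps)

lemma free_mult_diff_right: "free_mult m p (q - q') = free_mult m p q - free_mult m p q'"
  by (simp add: free_mult_def frag_extend_diff frag_extend_def[of _ p] case_prod_unfold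
      frag_cmul_diff_distrib2 sum_subtractf)

lemma free_mult_of: "free_mult m (frag_of (a, f)) (frag_of (b, g)) = frag_of (m a b, f * g)"
  by (simp add: free_mult_def)

lemma free_mult_0 [simp]: "free_mult m 0 q = 0" "free_mult m p 0 = 0"
  using free_mult_diff_left[of m 0 0] free_mult_diff_right[of m p 0 0] by auto

context nonassoc_algebra
begin

lemma tensor_relations_mult_left:
  fixes i :: "'k \<Rightarrow> 'f::field"
  assumes "p \<in> tensor_relations scale (\<lambda>c f. i c * f)"
  shows "free_mult mul p q \<in> tensor_relations scale (\<lambda>c f. i c * f)"
proof (induction q rule: frag_induction[OF subset_UNIV])
  case 1
  show ?case by (simp add: tensor_relations_zero)
next
  case (2 bg)
  obtain b g where bg: "bg = (b, g)" by fastforce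
  show ?case using assms unfolding bg
  proof induction
    case (balanced c x w)
    show ?case
      using tensor_relations.balanced[of scale c "mul x b" "w * g" "\<lambda>c f. i c * f"]
      by (simp add: free_mult_diff_left free_mult_of mult_scale_left mult.assoc)
  qed (auto simp: free_mult_diff_left free_mult_of mult_add_left distrib_right
         intro: tensor_relations.intros)
next
  case (3 p q)
  then show ?case by (simp add: free_mult_diff_right tensor_relations.diff)
qed

lemma tensor_relations_mult_right:
  fixes i :: "'k \<Rightarrow> 'f::field"
  assumes "q \<in> tensor_relations scale (\<lambda>c f. i c * f)"
  shows "free_mult mul p q \<in> tensor_relations scale (\<lambda>c f. i c * f)"
proof (induction p rule: frag_induction[OF subset_UNIV])
  case 1
  show ?case by (simp add: tensor_relations_zero)
next
  case (2 bg)
  obtain b g where bg: "bg = (b, g)" by fastforce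
  show ?case using assms unfolding bg
  proof induction
    case (balanced c x w)
    show ?case
      using tensor_relations.balanced[of scale c "mul b x" "g * w" "\<lambda>c f. i c * f"]
      by (simp add: free_mult_diff_right free_mult_of mult_scale_right mult.left_commute)
  qed (auto simp: free_mult_diff_right free_mult_of mult_add_right distrib_left
         intro: tensor_relations.intros)
next
  case (3 p q)
  then show ?case by (simp add: free_mult_diff_left tensor_relations.diff)
qed

lemma base_change_add:
  fixes i :: "'k \<Rightarrow> 'f::field"
  defines "r \<equiv> tensor_equiv scale (\<lambda>c f. i c * f)"
  shows "alg_add (base_change scale mul i) (r `` {p}) (r `` {q}) = r `` {p + q}"
proof -
  have "congruent2 r r (\<lambda>p q. r `` {p + q})"
    unfolding r_def
    by (intro congruent2I' equiv_class_eq[OF equiv_tensor_equiv])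
      (auto simp: tensor_equiv_def add_diff_add intro: tensor_relations_add)
  then show ?thesis
    by (simp add: base_change_def Let_def flip: r_def)
      (simp add: UN_equiv_class2[OF equiv_tensor_equiv equiv_tensor_equiv] r_def)
qed

lemma base_change_scale:
  fixes i :: "'k \<Rightarrow> 'f::field"
  defines "r \<equiv> tensor_equiv scale (\<lambda>c f. i c * f)"
  shows "alg_scale (base_change scale mul i) g (r `` {p}) = r `` {free_scale g p}"
proof -
  have "congruent r (\<lambda>p. r `` {free_scale g p})"
    unfolding r_def
    by (intro congruentI equiv_class_eq[OF equiv_tensor_equiv])
      (auto simp: tensor_equiv_def free_scale_def simp flip: frag_extend_diff
        intro: tensor_relations_scale[unfolded free_scale_def])
  then show ?thesis
    by (simp add: base_change_def Let_def flip: r_def)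
      (simp add: UN_equiv_class[OF equiv_tensor_equiv] r_def)
qed

lemma base_change_mult:
  fixes i :: "'k \<Rightarrow> 'f::field"
  defines "r \<equiv> tensor_equiv scale (\<lambda>c f. i c * f)"
  shows "alg_mult (base_change scale mul i) (r `` {p}) (r `` {q}) = r `` {free_mult mul p q}"
proof -
  have "(free_mult mul p q, free_mult mul p' q') \<in> r" if "(p, p') \<in> r" "(q, q') \<in> r" for p p' q q'
  proof -
    have "free_mult mul p q - free_mult mul p' q' =
        free_mult mul (p - p') q + free_mult mul p' (q - q')"
      by (simp add: free_mult_diff_left free_mult_diff_right)
    then show ?thesis
      using that tensor_relations_mult_left tensor_relations_mult_right
      by (auto simp: r_def tensor_equiv_def intro!: tensor_relations_add)
  qed
  then have "congruent2 r r (\<lambda>p q. r `` {free_mult mul p q})"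
    by (intro congruent2I' equiv_class_eq[OF equiv_tensor_equiv[of scale "\<lambda>c f. i c * f", folded r_def]])
  then show ?thesis
    by (simp add: base_change_def Let_def flip: r_def)
      (simp add: UN_equiv_class2[OF equiv_tensor_equiv equiv_tensor_equiv] r_def)
qed

end

end

theory Submission
  imports Defs "HOL-Library.Function_Algebras"
begin

text \<open>
  Fix bases \<open>EA\<close> of \<open>A\<close> and \<open>EB\<close> of \<open>B\<close> over \<open>K\<close>. An isomorphism between their base
  changes to \<open>F\<^sub>1\<close> amounts to a pair of mutually inverse matrices \<open>P\<close>, \<open>Q\<close> with finitely supported rows, indexed
  by the two bases, such that \<open>P\<close> respects multiplication. Each of these conditions says that some
  finite expression in the entries, with structure constants from \<open>K\<close> as coefficients, takes a
  prescribed value. A ring homomorphism over \<open>K\<close> from the subring of \<open>F\<^sub>1\<close> generated by the entries to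
  \<open>F\<^sub>2\<close> therefore carries \<open>P\<close> and \<open>Q\<close> to an isomorphism over \<open>F\<^sub>2\<close>; supports do not grow, because zero
  goes to zero (\<open>model_isomorphism_transfer\<close>). It remains to find such a homomorphism, and this is a
  form of the Nullstellensatz: a subring of \<open>F\<^sub>1\<close> generated over \<open>K\<close> by a set \<open>S\<close> of cardinality less
  than that of the algebraically closed field \<open>F\<^sub>2\<close> has a homomorphism over \<open>K\<close> to \<open>F\<^sub>2\<close>
  (\<open>specialization\<close>).
  
  For the Nullstellensatz take a maximal algebraically independent \<open>T \<subseteq> S\<close>. Every other \<open>x \<in> S\<close> is a
  root of a nonzero polynomial over \<open>K[T]\<close>, whose leading coefficient is a nonzero polynomial function
  on the points of \<open>F\<^sub>2\<^sup>T\<close>. There are fewer of these functions than elements of \<open>F\<^sub>2\<close>, so a point can be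
  chosen, one coordinate after the other, where none of them vanishes: at each step each function
  excludes only finitely many values (\<open>common_nonzero\<close>). Evaluation at this point is a homomorphism
  from \<open>K[T]\<close> to \<open>F\<^sub>2\<close>. Extend it to a maximal homomorphism from a subring of \<open>F\<^sub>1\<close> to \<open>F\<^sub>2\<close>. As in
  Chevalley's extension theorem its domain is a valuation ring, and a root of a polynomial over a
  valuation ring lies in the ring as soon as the leading coefficient does not go to zero in the
  residue field (\<open>in_place_if_algebraic\<close>). So the domain contains \<open>S\<close>.
  
  The argument covers finite and infinite dimension at once. The cardinality of \<open>K\<close> matters only
  through that of \<open>F\<^sub>2\<close>: since \<open>F\<^sub>2\<close> is infinite and larger than \<open>EA\<close> and \<open>EB\<close>, it is larger than
  \<open>EA \<times> EB\<close>, hence larger than the set of matrix entries.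
\<close>

section \<open>Graphs of partial ring homomorphisms\<close>

text \<open>
  A homomorphism from a subring of one ring to another ring is handled through its graph, a subring of
  the product ring. Graphs make extension of homomorphisms an inclusion of sets, and well-definedness
  becomes a property that can be checked after the subring has been built.
\<close>

locale ring_relation =
  fixes H :: "('r::comm_ring_1 \<times> 's::comm_ring_1) set"
  assumes one: "(1, 1) \<in> H"
    and diff: "(a, b) \<in> H \<Longrightarrow> (a', b') \<in> H \<Longrightarrow> (a - a', b - b') \<in> H"
    and mult: "(a, b) \<in> H \<Longrightarrow> (a', b') \<in> H \<Longrightarrow> (a * a', b * b') \<in> H"
begin

lemma zero: "(0, 0) \<in> H"
  using diff[OF one one] by simp

lemma add: "(a, b) \<in> H \<Longrightarrow> (a', b') \<in> H \<Longrightarrow> (a + a', b + b') \<in> H"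
  using diff[of a b "0 - a'" "0 - b'"] diff[OF zero] by simp

lemma sum: "(\<And>j. j \<in> J \<Longrightarrow> (f j, g j) \<in> H) \<Longrightarrow> (sum f J, sum g J) \<in> H"
  by (induction J rule: infinite_finite_induct) (auto intro: zero add)

lemma power: "(a, b) \<in> H \<Longrightarrow> (a ^ n, b ^ n) \<in> H"
  by (induction n) (auto intro: one mult)

end

text \<open>
  For a subring of a product this is equivalent to being the graph of a function.
\<close>

definition single_valued_at_0 :: "('r::zero \<times> 's::zero) set \<Rightarrow> bool" where
  "single_valued_at_0 H \<longleftrightarrow> (\<forall>b. (0, b) \<in> H \<longrightarrow> b = 0)"

text \<open>
  The graph of the map on polynomials that is induced coefficientwise. Adjoining \<open>(x, y)\<close> then
  means extending the homomorphism by \<open>x \<mapsto> y\<close>, which is well-defined if and only if \<open>y\<close> is a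
  root of the images of all polynomials with root \<open>x\<close>.
\<close>

definition poly_pairs :: "('r::comm_ring_1 \<times> 's::comm_ring_1) set \<Rightarrow> ('r poly \<times> 's poly) set" where
  "poly_pairs H = {(p, q). \<forall>n. (coeff p n, coeff q n) \<in> H}"

definition adjoin :: "('r::comm_ring_1 \<times> 's::comm_ring_1) set \<Rightarrow> 'r \<Rightarrow> 's \<Rightarrow> ('r \<times> 's) set" where
  "adjoin H x y = {(poly p x, poly q y) | p q. (p, q) \<in> poly_pairs H}"

lemma poly_pairsD: "(p, q) \<in> poly_pairs H \<Longrightarrow> (coeff p n, coeff q n) \<in> H"
  by (simp add: poly_pairs_def)

context ring_relation
begin

lemma monom_poly_pairs: "(a, b) \<in> H \<Longrightarrow> (monom a n, monom b n) \<in> poly_pairs H"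
  by (simp add: poly_pairs_def zero)

lemma ring_relation_poly_pairs: "ring_relation (poly_pairs H)"
proof
  show "(1, 1) \<in> poly_pairs H"
    using monom_poly_pairs[OF one, of 0] by simp
next
  fix p q p' q'
  assume "(p, q) \<in> poly_pairs H" and "(p', q') \<in> poly_pairs H"
  then show "(p - p', q - q') \<in> poly_pairs H" "(p * p', q * q') \<in> poly_pairs H"
    by (auto simp: poly_pairs_def coeff_mult intro!: diff sum mult)
qed

lemma ring_relation_adjoin: "ring_relation (adjoin H x y)"
proof -
  interpret P: ring_relation "poly_pairs H"
    by (rule ring_relation_poly_pairs)
  show ?thesis
  proof
    show "(1, 1) \<in> adjoin H x y"
      using P.one by (force simp: adjoin_def)
  next
    fix a b a' b'
    assume "(a, b) \<in> adjoin H x y" and "(a', b') \<in> adjoin H x y"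
    then obtain p q p' q' where *: "(p, q) \<in> poly_pairs H" "(p', q') \<in> poly_pairs H"
      and [simp]: "a = poly p x" "b = poly q y" "a' = poly p' x" "b' = poly q' y"
      by (auto simp: adjoin_def)
    show "(a - a', b - b') \<in> adjoin H x y"
      using P.diff[OF *] by (force simp: adjoin_def)
    show "(a * a', b * b') \<in> adjoin H x y"
      using P.mult[OF *] by (force simp: adjoin_def)
  qed
qed

lemma adjoin_superset: "H \<subseteq> adjoin H x y"
proof clarify
  fix a b assume "(a, b) \<in> H"
  from monom_poly_pairs[OF this, of 0] show "(a, b) \<in> adjoin H x y"
    by (force simp: adjoin_def poly_monom)
qed

lemma adjoin_element: "(x, y) \<in> adjoin H x y"
  using monom_poly_pairs[OF one, of 1] by (force simp: adjoin_def poly_monom)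

text \<open>
  Evaluation at \<open>1 / u\<close> after clearing denominators stays inside the ring; this transports statements
  about \<open>inverse u\<close> to the ring when only \<open>u\<close> is known to lie in it.
\<close>
lemma homogenized_poly:
  assumes "(p, q) \<in> poly_pairs H" and "(u, w) \<in> H"
  shows "(\<Sum>j\<le>n. coeff p j * u ^ (n - j), \<Sum>j\<le>n. coeff q j * w ^ (n - j)) \<in> H"
  using assms by (intro sum mult power poly_pairsD)

end

lemma homogenized_poly_eq:
  fixes u :: "'f::field"
  assumes "u \<noteq> 0" and "degree p \<le> n"
  shows "(\<Sum>j\<le>n. coeff p j * u ^ (n - j)) = u ^ n * poly p (inverse u)"
proof -
  have "poly p (inverse u) = (\<Sum>j\<le>n. coeff p j * inverse u ^ j)"
    unfolding poly_altdef using assms(2)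
    by (intro sum.mono_neutral_left) (auto simp: coeff_eq_0)
  then show ?thesis
    using assms(1) by (simp add: sum_distrib_left power_diff field_simps)
qed


section \<open>Maximal places\<close>

text \<open>
  The graph of a homomorphism into an algebraically closed field, defined on a subring of a field, that
  has no proper extension of this kind.
\<close>

locale maximal_place = ring_relation H
  for H :: "('f::field \<times> 'g::alg_closed_field) set" +
  assumes single_valued: "(0, b) \<in> H \<Longrightarrow> b = 0"
    and maximal: "\<And>H'. ring_relation H' \<Longrightarrow> single_valued_at_0 H' \<Longrightarrow> H \<subseteq> H' \<Longrightarrow> H' = H"
begin

lemma in_place_if_adjoin:
  assumes "single_valued_at_0 (adjoin H x y)"
  shows "(x, y) \<in> H"
  using maximal[OF ring_relation_adjoin assms adjoin_superset] adjoin_element[of x y] by simp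

text \<open>
  The domain is local and its maximal ideal is the kernel: otherwise the homomorphism would extend to
  the localisation at an element outside the kernel.
\<close>

lemma inverse_mem:
  assumes "(a, b) \<in> H" and "b \<noteq> 0"
  shows "(inverse a, inverse b) \<in> H"
proof (rule in_place_if_adjoin)
  have "a \<noteq> 0" using assms single_valued by auto
  have "poly q (inverse b) = 0" if pq: "(p, q) \<in> poly_pairs H" and 0: "poly p (inverse a) = 0" for p q
  proof -
    let ?n = "max (degree p) (degree q)"
    from homogenized_poly[OF pq assms(1), of ?n]
    have "(a ^ ?n * poly p (inverse a), b ^ ?n * poly q (inverse b)) \<in> H"
      using \<open>a \<noteq> 0\<close> \<open>b \<noteq> 0\<close> by (simp add: homogenized_poly_eq)
    then have "b ^ ?n * poly q (inverse b) = 0"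
      by (intro single_valued) (simp add: 0)
    then show ?thesis using \<open>b \<noteq> 0\<close> by simp
  qed
  then show "single_valued_at_0 (adjoin H (inverse a) (inverse b))"
    by (auto simp: single_valued_at_0_def adjoin_def)
qed

text \<open>
  Let \<open>J\<close> be the set of images of the polynomials over the domain that vanish at \<open>x\<close>. By maximality \<open>x\<close>
  is in the domain once all members of \<open>J\<close> have a common root. As the image of the domain is a field,
  \<open>J\<close> is an ideal over it and, unless zero, generated by a nonzero member of least degree. This
  generator has a root unless it is constant, which the assumption excludes.
\<close>

lemma in_place_if_no_unit_relation:
  assumes no_unit: "\<And>p. (p, 1) \<in> poly_pairs H \<Longrightarrow> poly p x \<noteq> 0"
  shows "\<exists>y. (x, y) \<in> H"
proof -
  interpret P: ring_relation "poly_pairs H"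
    by (rule ring_relation_poly_pairs)
  define J where "J = {q. \<exists>p. (p, q) \<in> poly_pairs H \<and> poly p x = 0}"
  have "\<exists>y. \<forall>q\<in>J. poly q y = 0"
  proof (cases "J \<subseteq> {0}")
    case True
    then have "poly q 0 = 0" if "q \<in> J" for q using that by auto
    then show ?thesis by blast
  next
    case False
    define q0 where "q0 = arg_min degree (\<lambda>q. q \<in> J \<and> q \<noteq> 0)"
    have q0: "q0 \<in> J" "q0 \<noteq> 0" and q0_min: "\<And>q. q \<in> J \<Longrightarrow> q \<noteq> 0 \<Longrightarrow> degree q0 \<le> degree q"
      using False arg_min_nat_lemma[of "\<lambda>q. q \<in> J \<and> q \<noteq> 0" _ degree] unfolding q0_def by blast+
    obtain p0 where p0: "(p0, q0) \<in> poly_pairs H" "poly p0 x = 0"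
      using q0 by (auto simp: J_def)
    have lead0: "(inverse (coeff p0 (degree q0)), inverse (lead_coeff q0)) \<in> H"
      using q0 poly_pairsD[OF p0(1)] by (intro inverse_mem) auto
    have "degree q0 \<noteq> 0"
    proof
      assume *: "degree q0 = 0"
      have "q0 * monom (inverse (lead_coeff q0)) 0 = 1"
        using q0(2) * by (auto elim!: degree_eq_zeroE simp: monom_0 one_pCons)
      with P.mult[OF p0(1) monom_poly_pairs[OF lead0, of 0]] no_unit p0(2) show False
        by fastforce
    qed
    then obtain y where y: "poly q0 y = 0"
      using alg_closed_imp_poly_has_root[of q0] by auto
    \<comment> \<open>Division by \<open>q0\<close>, one leading term at a time, so that coefficients never leave the image of the
      domain.\<close>
    have "poly q y = 0" if "q \<in> J" for q
      using that
    proof (induction "degree q" arbitrary: q rule: less_induct)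
      case less
      show ?case
      proof (cases "degree q0 \<le> degree q")
        case False
        then show ?thesis using q0_min[OF less.prems] by (cases "q = 0") auto
      next
        case True
        let ?n = "degree q"
        obtain p where p: "(p, q) \<in> poly_pairs H" "poly p x = 0"
          using less.prems by (auto simp: J_def)
        define c where "c = lead_coeff q * inverse (lead_coeff q0)"
        define r where "r = q - monom c (?n - degree q0) * q0"
        have "(p - monom (coeff p ?n * inverse (coeff p0 (degree q0))) (?n - degree q0) * p0, r)
            \<in> poly_pairs H"
          unfolding r_def c_def
          by (intro P.diff P.mult monom_poly_pairs mult p p0 lead0 poly_pairsD[OF p(1)])
        then have "r \<in> J" using p p0 by (force simp: J_def)
        have deg: "degree r \<le> ?n"
        proof -
          have "degree (monom c (?n - degree q0) * q0) \<le> ?n"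
            using degree_mult_le[of "monom c (?n - degree q0)" q0] degree_monom_le[of c "?n - degree q0"]
              True by linarith
          then show ?thesis unfolding r_def by (intro degree_diff_le) auto
        qed
        have "coeff r ?n = 0"
          using True q0(2) by (simp add: r_def c_def coeff_monom_mult)
        with deg have "r = 0 \<or> degree r < ?n" by (rule eq_zero_or_degree_less)
        with less.hyps \<open>r \<in> J\<close> have "poly r y = 0" by auto
        then show ?thesis using y by (simp add: r_def)
      qed
    qed
    then show ?thesis by auto
  qed
  then obtain y where y: "\<And>q. q \<in> J \<Longrightarrow> poly q y = 0" by auto
  then have "single_valued_at_0 (adjoin H x y)"
    unfolding single_valued_at_0_def adjoin_def J_def by force
  then show ?thesis using in_place_if_adjoin by auto
qed

text \<open>
  The relation \<open>p'\<close> for \<open>inverse x\<close>, multiplied by a power of \<open>x\<close>, has an invertible leading coefficient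
  and all its other coefficients in the kernel. Subtracting a multiple of it from \<open>p\<close> removes the
  leading term; the multiplier is in the kernel, as \<open>p\<close> is not constant, so the image of \<open>p\<close> does not
  change.
\<close>

lemma unit_relation_descent:
  assumes p: "(p, 1) \<in> poly_pairs H" "poly p x = 0"
    and p': "(p', 1) \<in> poly_pairs H" "poly p' (inverse x) = 0"
    and "x \<noteq> 0" and deg: "degree p' \<le> degree p"
  shows "\<exists>r. (r, 1) \<in> poly_pairs H \<and> poly r x = 0 \<and> degree r < degree p"
proof -
  interpret P: ring_relation "poly_pairs H"
    by (rule ring_relation_poly_pairs)
  let ?m = "degree p'" and ?n = "degree p"
  define a where "a = coeff p' 0"
  have a: "(a, 1) \<in> H"
    using poly_pairsD[OF p'(1), of 0] by (simp add: a_def)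
  then have "a \<noteq> 0" using single_valued[of 1] by auto
  have inv_a: "(inverse a, 1) \<in> H" using inverse_mem[OF a] by simp
  have "?m > 0"
    using p'(2) \<open>a \<noteq> 0\<close> by (auto simp: a_def poly_altdef intro: gr0I)
  then have n: "?n > 0" using deg by simp
  have refl: "(reflect_poly p', monom 1 ?m) \<in> poly_pairs H"
    unfolding poly_pairs_def
  proof clarify
    fix j
    show "(coeff (reflect_poly p') j, coeff (monom 1 ?m) j) \<in> H"
      using poly_pairsD[OF p'(1), of "?m - j"] zero
      by (cases "j \<le> ?m") (auto simp: coeff_reflect_poly coeff_eq_0 split: if_splits)
  qed
  define s where "s = monom (lead_coeff p * inverse a) (?n - ?m) * reflect_poly p'"
  have "(lead_coeff p, 0) \<in> H"
    using poly_pairsD[OF p(1), of ?n] n by (simp add: coeff_eq_0)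
  from mult[OF this inv_a] have "(lead_coeff p * inverse a, 0) \<in> H" by simp
  from P.mult[OF monom_poly_pairs[OF this, of "?n - ?m"] refl] have s: "(s, 0) \<in> poly_pairs H"
    by (simp add: s_def)
  have "(p - s, 1) \<in> poly_pairs H"
    using P.diff[OF p(1) s] by simp
  moreover have "poly (p - s) x = 0"
    using p p' \<open>x \<noteq> 0\<close> by (simp add: s_def poly_reflect_poly_nz)
  moreover have "degree (p - s) < ?n"
  proof -
    have "degree s \<le> ?n"
      unfolding s_def
      using degree_mult_le[of "monom (lead_coeff p * inverse a) (?n - ?m)" "reflect_poly p'"]
        degree_monom_le[of "lead_coeff p * inverse a" "?n - ?m"] degree_reflect_poly_le[of p'] deg
      by linarith
    then have "degree (p - s) \<le> ?n" by (intro degree_diff_le) auto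
    moreover have "coeff (p - s) ?n = 0"
      using deg \<open>a \<noteq> 0\<close> by (simp add: s_def coeff_monom_mult coeff_reflect_poly a_def)
    ultimately show ?thesis using eq_zero_or_degree_less[of "p - s" ?n] n by auto
  qed
  ultimately show ?thesis by blast
qed

lemma no_opposite_unit_relations:
  assumes "(p, 1) \<in> poly_pairs H" "poly p x = 0"
    and "(p', 1) \<in> poly_pairs H" "poly p' (inverse x) = 0"
    and "x \<noteq> 0"
  shows False
  using assms
proof (induction "degree p + degree p'" arbitrary: p p' rule: less_induct)
  case less
  show ?case
  proof (cases "degree p' \<le> degree p")
    case True
    then show ?thesis
      using unit_relation_descent[of p x p'] less by (meson add_less_cancel_right)
  next
    case False
    then show ?thesis
      using unit_relation_descent[of p' "inverse x" p] less
      by (metis add_less_cancel_left inverse_inverse_eq inverse_nonzero_iff_nonzero nat_le_linear)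
  qed
qed

lemma valuation:
  assumes "x \<noteq> 0"
  shows "(\<exists>y. (x, y) \<in> H) \<or> (\<exists>y. (inverse x, y) \<in> H)"
  using in_place_if_no_unit_relation no_opposite_unit_relations assms by metis

text \<open>
  If \<open>x\<close> were outside the domain then \<open>inverse x\<close> would lie in it and go to \<open>0\<close>. Dividing the
  equation for \<open>x\<close> by \<open>x ^ degree q\<close> and applying the homomorphism would leave only the leading
  coefficient of \<open>q\<close>, which is not \<open>0\<close>.
\<close>

lemma in_place_if_algebraic:
  assumes pq: "(p, q) \<in> poly_pairs H" and "q \<noteq> 0" and deg: "degree p \<le> degree q" and root: "poly p x = 0"
  shows "\<exists>y. (x, y) \<in> H"
proof (rule ccontr)
  assume *: "\<not> ?thesis"
  then have "x \<noteq> 0" using zero by auto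
  with valuation * obtain w where w: "(inverse x, w) \<in> H" by auto
  have "w = 0"
    using inverse_mem[OF w] * by auto
  let ?n = "degree q"
  from homogenized_poly[OF pq w, of ?n]
  have "(0, \<Sum>j\<le>?n. coeff q j * w ^ (?n - j)) \<in> H"
    using \<open>x \<noteq> 0\<close> root deg by (simp add: homogenized_poly_eq)
  moreover have "(\<Sum>j\<le>?n. coeff q j * w ^ (?n - j)) = (\<Sum>j\<le>?n. if j = ?n then lead_coeff q else 0)"
    using \<open>w = 0\<close> by (intro sum.cong) auto
  ultimately have "(0, lead_coeff q) \<in> H" by simp
  with single_valued \<open>q \<noteq> 0\<close> show False by fastforce
qed

end

lemma chain_pairE:
  assumes "subset.chain \<A> C" and "u \<in> \<Union>C" and "v \<in> \<Union>C"
  obtains X where "X \<in> C" "u \<in> X" "v \<in> X"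
  using assms by (fastforce simp: subset.chain_def)

lemma maximal_place_exists:
  fixes H :: "('f::field \<times> 'g::alg_closed_field) set"
  assumes "ring_relation H" and "single_valued_at_0 H"
  shows "\<exists>M. H \<subseteq> M \<and> maximal_place M"
proof -
  define \<A> where "\<A> = {X. ring_relation X \<and> single_valued_at_0 X \<and> H \<subseteq> X}"
  have "\<exists>M\<in>\<A>. \<forall>X\<in>\<A>. M \<subseteq> X \<longrightarrow> X = M"
  proof (rule subset_Zorn_nonempty)
    show "\<A> \<noteq> {}" using assms by (auto simp: \<A>_def)
  next
    fix C assume C: "C \<noteq> {}" "subset.chain \<A> C"
    then have mem: "ring_relation X" "single_valued_at_0 X" "H \<subseteq> X" if "X \<in> C" for X
      using that by (auto simp: \<A>_def subset.chain_def)
    have "ring_relation (\<Union>C)"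
    proof
      show "(1, 1) \<in> \<Union>C" using C(1) mem(1) ring_relation.one by fastforce
    next
      fix a b a' b' assume "(a, b) \<in> \<Union>C" "(a', b') \<in> \<Union>C"
      then obtain X where X: "X \<in> C" "(a, b) \<in> X" "(a', b') \<in> X"
        by (rule chain_pairE[OF C(2)])
      interpret ring_relation X using mem(1) X(1) .
      show "(a - a', b - b') \<in> \<Union>C" "(a * a', b * b') \<in> \<Union>C"
        using UnionI[OF X(1) diff[OF X(2,3)]] UnionI[OF X(1) mult[OF X(2,3)]] by auto
    qed
    moreover have "single_valued_at_0 (\<Union>C)"
      using mem(2) by (auto simp: single_valued_at_0_def)
    moreover have "H \<subseteq> \<Union>C" using C(1) mem(3) by blast
    ultimately show "\<Union>C \<in> \<A>" by (simp add: \<A>_def)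
  qed
  then obtain M where M: "M \<in> \<A>" and max: "\<And>X. X \<in> \<A> \<Longrightarrow> M \<subseteq> X \<Longrightarrow> X = M" by blast
  have M': "ring_relation M" "single_valued_at_0 M" "H \<subseteq> M"
    using M by (auto simp: \<A>_def)
  have "X = M" if "ring_relation X" "single_valued_at_0 X" "M \<subseteq> X" for X
    using that M' by (intro max) (auto simp: \<A>_def)
  then have "maximal_place M"
    unfolding maximal_place_def maximal_place_axioms_def
    using M' by (simp add: single_valued_at_0_def)
  then show ?thesis using M by (auto simp: \<A>_def)
qed


section \<open>Common nonzeros of few polynomial functions\<close>

lemma alg_closed_field_infinite: "infinite (UNIV :: 'g::alg_closed_field set)"
proof
  assume fin: "finite (UNIV :: 'g set)"
  define p where "p = (\<Prod>a\<in>(UNIV :: 'g set). [:- a, 1:]) + 1"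
  have "poly p x = 1" for x
    using fin by (auto simp: p_def poly_prod prod_zero_iff)
  moreover have "degree p > 0"
  proof -
    have "degree (\<Prod>a\<in>(UNIV :: 'g set). [:- a, 1:]) = card (UNIV :: 'g set)"
      by (subst degree_prod_sum_eq) auto
    moreover have "card (UNIV :: 'g set) > 0" using fin by (simp add: finite_UNIV_card_ge_0)
    ultimately show ?thesis unfolding p_def by (subst degree_add_eq_left) auto
  qed
  ultimately show False using alg_closed_imp_poly_has_root[of p] by auto
qed

lemma finite_ordLess_infinite_set: "finite A \<Longrightarrow> infinite B \<Longrightarrow> |A| <o |B|"
  by (intro finite_ordLess_infinite card_of_Well_order) (simp_all add: Field_card_of)

text \<open>
  The disjoint sum \<open>A <+> B\<close> serves as a common upper bound that is still smaller than \<open>C\<close>.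
\<close>

lemma card_of_Times_ordLess:
  assumes inf: "infinite C" and A: "|A| <o |C|" and B: "|B| <o |C|"
  shows "|A \<times> B| <o |C|"
proof (cases "finite (A <+> B)")
  case True
  then have "finite (A \<times> B)" by simp
  then show ?thesis using inf by (rule finite_ordLess_infinite_set)
next
  case False
  then have "|A \<times> B| \<le>o |A <+> B|"
    by (intro card_of_Sigma_ordLeq_infinite) (auto intro: card_of_Plus1 card_of_Plus2)
  then show ?thesis
    using card_of_Plus_ordLess_infinite[OF inf A B] by (rule ordLeq_ordLess_trans)
qed

lemma ex_outside_few_finite_sets:
  assumes inf: "infinite (UNIV :: 'g set)" and few: "|I| <o |UNIV :: 'g set|"
    and fin: "\<And>i. i \<in> I \<Longrightarrow> finite (B i)"
  shows "\<exists>z :: 'g. \<forall>i\<in>I. z \<notin> B i"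
proof -
  have "(\<Union>i\<in>I. B i) \<noteq> UNIV"
  proof (cases "finite I")
    case True
    then show ?thesis using fin inf by (metis finite_UN)
  next
    case False
    then have "|B i| \<le>o |I|" if "i \<in> I" for i
      using fin[OF that] by (intro ordLess_imp_ordLeq finite_ordLess_infinite_set)
    then have "|\<Union>i\<in>I. B i| \<le>o |I|"
      using False card_of_UNION_ordLeq_infinite card_of_mono1 by blast
    then have "|\<Union>i\<in>I. B i| <o |UNIV :: 'g set|"
      using few by (rule ordLeq_ordLess_trans)
    then show ?thesis by (metis ordLess_irreflexive)
  qed
  then show ?thesis by auto
qed

text \<open>
  A partial point is the graph of a function on some of the coordinates. Call it admissible if every
  \<open>\<phi>\<close> in the family is nonzero at some total point extending it, which may depend on \<open>\<phi>\<close>.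
  Admissibility passes to unions of chains because each \<open>\<phi>\<close> looks at finitely many coordinates only.
  An admissible partial point can be extended by one more coordinate because each \<open>\<phi>\<close>, as a nonzero
  polynomial in this coordinate, excludes finitely many values. So a maximal admissible partial point
  is total.
\<close>

lemma common_nonzero:
  fixes \<Phi> :: "(('x \<Rightarrow> 'g::idom) \<Rightarrow> 'g) set"
  assumes inf: "infinite (UNIV :: 'g set)" and few: "|\<Phi>| <o |UNIV :: 'g set|"
    and finitary: "\<And>\<phi>. \<phi> \<in> \<Phi> \<Longrightarrow> \<exists>U. finite U \<and> (\<forall>c c'. (\<forall>t\<in>U. c t = c' t) \<longrightarrow> \<phi> c = \<phi> c')"
    and polynomial: "\<And>\<phi> c t. \<phi> \<in> \<Phi> \<Longrightarrow> \<exists>r. \<forall>z. \<phi> (c(t := z)) = poly r z"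
    and nonzero: "\<And>\<phi>. \<phi> \<in> \<Phi> \<Longrightarrow> \<exists>c. \<phi> c \<noteq> 0"
  shows "\<exists>c. \<forall>\<phi>\<in>\<Phi>. \<phi> c \<noteq> 0"
proof (cases "\<Phi> = {}")
  case False
  define extends where "extends c R \<longleftrightarrow> (\<forall>(t, v)\<in>R. c t = v)" for c :: "'x \<Rightarrow> 'g" and R
  define \<A> where "\<A> = {R. \<forall>\<phi>\<in>\<Phi>. \<exists>c. extends c R \<and> \<phi> c \<noteq> 0}"
  have "\<exists>M\<in>\<A>. \<forall>R\<in>\<A>. M \<subseteq> R \<longrightarrow> R = M"
  proof (rule subset_Zorn_nonempty)
    have "{} \<in> \<A>" using nonzero by (simp add: \<A>_def extends_def)
    then show "\<A> \<noteq> {}" by blast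
  next
    fix C assume C: "C \<noteq> {}" "subset.chain \<A> C"
    then have mem: "R \<in> \<A>" if "R \<in> C" for R
      using that by (auto simp: subset.chain_def)
    have single_valued: "v = v'" if tv: "(t, v) \<in> \<Union>C" "(t, v') \<in> \<Union>C" for t v v'
    proof -
      obtain R where R: "R \<in> C" "(t, v) \<in> R" "(t, v') \<in> R"
        using chain_pairE[OF C(2) tv] .
      obtain c where c: "extends c R" using mem[OF R(1)] False by (auto simp: \<A>_def)
      have "c t = v" using c R(2) by (auto simp: extends_def)
      moreover have "c t = v'" using c R(3) by (auto simp: extends_def)
      ultimately show ?thesis by simp
    qed
    show "\<Union>C \<in> \<A>"
      unfolding \<A>_def
    proof clarify
      fix \<phi> assume \<phi>: "\<phi> \<in> \<Phi>"
      obtain U where U: "finite U" "\<And>c c'. (\<And>t. t \<in> U \<Longrightarrow> c t = c' t) \<Longrightarrow> \<phi> c = \<phi> c'"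
        using finitary[OF \<phi>] by metis
      define R0 where "R0 = {(t, v) \<in> \<Union>C. t \<in> U}"
      have "inj_on fst R0"
        using single_valued by (force simp: inj_on_def R0_def)
      moreover have "finite (fst ` R0)"
        using U(1) by (rule finite_subset[rotated]) (auto simp: R0_def)
      ultimately have "finite R0" by (rule finite_imageD[rotated])
      moreover have "R0 \<subseteq> \<Union>C" by (auto simp: R0_def)
      ultimately obtain R where R: "R \<in> C" "R0 \<subseteq> R"
        using C by (metis finite_subset_Union_chain)
      obtain c where c: "extends c R" "\<phi> c \<noteq> 0"
        using mem[OF R(1)] \<phi> by (auto simp: \<A>_def)
      \<comment> \<open>On \<open>U\<close> the point follows the witness for a single member of the chain, elsewhere the union.\<close>
      define c' where "c' t = (if t \<in> U then c t else SOME v. (t, v) \<in> \<Union>C)" for t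
      have "extends c' (\<Union>C)"
        unfolding extends_def
      proof clarify
        fix t v X assume tv: "(t, v) \<in> X" "X \<in> C"
        show "c' t = v"
        proof (cases "t \<in> U")
          case True
          then have "(t, v) \<in> R" using R(2) tv by (auto simp: R0_def)
          then show ?thesis using True c(1) by (auto simp: extends_def c'_def)
        next
          case False
          then show ?thesis
            using someI[of "\<lambda>v. (t, v) \<in> \<Union>C" v] tv single_valued by (auto simp: c'_def)
        qed
      qed
      moreover have "\<phi> c' = \<phi> c" by (rule U(2)) (simp add: c'_def)
      ultimately show "\<exists>c. extends c (\<Union>C) \<and> \<phi> c \<noteq> 0" using c(2) by auto
    qed
  qed
  then obtain M where M: "M \<in> \<A>" and max: "\<And>R. R \<in> \<A> \<Longrightarrow> M \<subseteq> R \<Longrightarrow> R = M" by blast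
  have "\<forall>\<phi>\<in>\<Phi>. \<exists>c. extends c M \<and> \<phi> c \<noteq> 0" using M by (simp add: \<A>_def)
  from bchoice[OF this] obtain e where e: "\<And>\<phi>. \<phi> \<in> \<Phi> \<Longrightarrow> extends (e \<phi>) M \<and> \<phi> (e \<phi>) \<noteq> 0" by blast
  have total: "\<exists>v. (t, v) \<in> M" for t
  proof -
    have "\<forall>\<phi>\<in>\<Phi>. \<exists>r. \<forall>z. \<phi> ((e \<phi>)(t := z)) = poly r z" using polynomial by blast
    from bchoice[OF this] obtain r
      where r: "\<And>\<phi> z. \<phi> \<in> \<Phi> \<Longrightarrow> \<phi> ((e \<phi>)(t := z)) = poly (r \<phi>) z" by blast
    have "\<exists>z. \<forall>\<phi>\<in>\<Phi>. z \<notin> {z. poly (r \<phi>) z = 0}"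
    proof (rule ex_outside_few_finite_sets[OF inf few])
      fix \<phi> assume "\<phi> \<in> \<Phi>"
      then have "poly (r \<phi>) (e \<phi> t) \<noteq> 0" using e[of \<phi>] r[of \<phi> "e \<phi> t"] by simp
      then show "finite {z. poly (r \<phi>) z = 0}" by (intro poly_roots_finite) auto
    qed
    then obtain z where z: "\<And>\<phi>. \<phi> \<in> \<Phi> \<Longrightarrow> \<phi> ((e \<phi>)(t := z)) \<noteq> 0" using r by auto
    show ?thesis
    proof (rule ccontr)
      assume new: "\<nexists>v. (t, v) \<in> M"
      then have "extends ((e \<phi>)(t := z)) (insert (t, z) M)" if "\<phi> \<in> \<Phi>" for \<phi>
        using e[OF that] by (auto simp: extends_def)
      then have "insert (t, z) M \<in> \<A>" using z by (auto simp: \<A>_def)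
      then have "insert (t, z) M = M" by (intro max) auto
      then show False using new by auto
    qed
  qed
  then obtain c where c: "\<And>t. (t, c t) \<in> M" by metis
  have "e \<phi> = c" if "\<phi> \<in> \<Phi>" for \<phi>
    using e[OF that] c by (force simp: extends_def)
  then show ?thesis using e by auto
qed auto


section \<open>Specialisation of few elements of a field\<close>

inductive_set ring_generated :: "('r::comm_ring_1 \<times> 's::comm_ring_1) set \<Rightarrow> ('r \<times> 's) set"
  for S where
  base: "(a, b) \<in> S \<Longrightarrow> (a, b) \<in> ring_generated S"
| one: "(1, 1) \<in> ring_generated S"
| diff: "(a, b) \<in> ring_generated S \<Longrightarrow> (a', b') \<in> ring_generated S \<Longrightarrow>
    (a - a', b - b') \<in> ring_generated S"
| mult: "(a, b) \<in> ring_generated S \<Longrightarrow> (a', b') \<in> ring_generated S \<Longrightarrow>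
    (a * a', b * b') \<in> ring_generated S"

lemma ring_relation_generated: "ring_relation (ring_generated S)"
  by standard (auto intro: ring_generated.intros)

lemma ring_generated_least:
  assumes "ring_relation H" and "S \<subseteq> H"
  shows "ring_generated S \<subseteq> H"
proof clarify
  interpret ring_relation H by fact
  fix a b assume "(a, b) \<in> ring_generated S"
  then show "(a, b) \<in> H"
    by induction (use assms(2) one diff mult in auto)
qed

lemma ring_generated_mono: "S \<subseteq> S' \<Longrightarrow> ring_generated S \<subseteq> ring_generated S'"
  by (intro ring_generated_least ring_relation_generated) (auto intro: ring_generated.base)

lemma ring_generated_insert:
  "ring_generated (insert (x, y) S) \<subseteq> adjoin (ring_generated S) x y"
proof -
  interpret ring_relation "ring_generated S" by (rule ring_relation_generated)
  show ?thesis
    using adjoin_superset[of x y] adjoin_element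
    by (intro ring_generated_least ring_relation_adjoin) (auto intro: ring_generated.base)
qed

lemma field_embedding_diff:
  assumes "field_embedding i"
  shows "i (x - y) = i x - i y"
proof -
  have "i (x - y + y) = i (x - y) + i y" using assms unfolding field_embedding_def by blast
  then show ?thesis by simp
qed

lemma field_embedding_0: "field_embedding i \<Longrightarrow> i 0 = 0"
  using field_embedding_diff[of i 0 0] by simp

lemma field_embedding_eq_0_iff:
  assumes "field_embedding i"
  shows "i x = 0 \<longleftrightarrow> x = 0"
proof
  show "x = 0" if "i x = 0"
  proof (rule ccontr)
    assume "x \<noteq> 0"
    then have "i 1 = i x * i (inverse x)"
      using assms unfolding field_embedding_def by (metis right_inverse)
    then show False using assms that by (simp add: field_embedding_def)
  qed
qed (simp add: field_embedding_0 assms)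

locale two_embeddings =
  fixes i1 :: "'k::field \<Rightarrow> 'f::field" and i2 :: "'k \<Rightarrow> 'g::alg_closed_field"
  assumes i1: "field_embedding i1" and i2: "field_embedding i2"
begin

text \<open>
  The second ring is the ring of functions on points \<open>c\<close>, one coordinate for each element of \<open>'f\<close>.
  The elements of \<open>generic T\<close> are the pairs formed by the value in \<open>'f\<close> of a polynomial over \<open>'k\<close> in
  the variables \<open>T\<close>, when each variable is replaced by itself, and the polynomial function that it
  defines over \<open>'g\<close>. The pairs stand for the polynomials, which are determined by their functions
  since \<open>'g\<close> is infinite. Algebraic independence of \<open>T\<close> then says that the value determines the
  function.
\<close>

definition generic :: "'f set \<Rightarrow> ('f \<times> (('f \<Rightarrow> 'g) \<Rightarrow> 'g)) set" where
  "generic T = ring_generated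
     (range (\<lambda>k. (i1 k, \<lambda>c. i2 k)) \<union> (\<lambda>t. (t, \<lambda>c. c t)) ` T)"

definition independent :: "'f set \<Rightarrow> bool" where
  "independent T \<longleftrightarrow> single_valued_at_0 (generic T)"

lemma ring_relation_generic: "ring_relation (generic T)"
  unfolding generic_def by (rule ring_relation_generated)

lemma generic_mono: "T \<subseteq> T' \<Longrightarrow> generic T \<subseteq> generic T'"
  unfolding generic_def by (intro ring_generated_mono) auto

lemma generic_insert: "generic (insert x T) \<subseteq> adjoin (generic T) x (\<lambda>c. c x)"
  using ring_generated_insert unfolding generic_def by simp

lemma generic_induct [consumes 1, case_names const var one diff mult]:
  assumes "(y, \<phi>) \<in> generic T"
    and "\<And>k. P (i1 k) (\<lambda>c. i2 k)" and "\<And>t. t \<in> T \<Longrightarrow> P t (\<lambda>c. c t)" and "P 1 1"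
    and "\<And>a \<phi> b \<psi>. (a, \<phi>) \<in> generic T \<Longrightarrow> (b, \<psi>) \<in> generic T \<Longrightarrow> P a \<phi> \<Longrightarrow> P b \<psi> \<Longrightarrow> P (a - b) (\<phi> - \<psi>)"
    and "\<And>a \<phi> b \<psi>. (a, \<phi>) \<in> generic T \<Longrightarrow> (b, \<psi>) \<in> generic T \<Longrightarrow> P a \<phi> \<Longrightarrow> P b \<psi> \<Longrightarrow> P (a * b) (\<phi> * \<psi>)"
  shows "P y \<phi>"
  using assms(1) unfolding generic_def
proof (induction rule: ring_generated.induct)
  case (base a b)
  then show ?case using assms(2,3) by auto
next
  case one
  show ?case by (rule assms(4))
next
  case (diff a b a' b')
  then show ?case by (intro assms(5)) (simp_all add: generic_def)
next
  case (mult a b a' b')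
  then show ?case by (intro assms(6)) (simp_all add: generic_def)
qed

lemma generic_finitary:
  assumes "(y, \<phi>) \<in> generic T"
  shows "\<exists>U. finite U \<and> U \<subseteq> T \<and> (y, \<phi>) \<in> generic U"
  using assms
proof (induction rule: generic_induct)
  case (const k)
  then show ?case unfolding generic_def by (auto intro: ring_generated.base)
next
  case (var t)
  then show ?case unfolding generic_def
    by (intro exI[of _ "{t}"]) (auto intro: ring_generated.base)
next
  case one
  then show ?case using ring_relation.one[OF ring_relation_generic] by blast
next
  case (diff a \<phi> b \<psi>)
  then obtain U V where U: "finite U" "U \<subseteq> T" "(a, \<phi>) \<in> generic U"
    and V: "finite V" "V \<subseteq> T" "(b, \<psi>) \<in> generic V" by metis
  have "(a, \<phi>) \<in> generic (U \<union> V)" "(b, \<psi>) \<in> generic (U \<union> V)"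
    using U(3) V(3) generic_mono[of U "U \<union> V"] generic_mono[of V "U \<union> V"] by auto
  from ring_relation.diff[OF ring_relation_generic this] show ?case
    using U V by (meson finite_Un Un_least)
next
  case (mult a \<phi> b \<psi>)
  then obtain U V where U: "finite U" "U \<subseteq> T" "(a, \<phi>) \<in> generic U"
    and V: "finite V" "V \<subseteq> T" "(b, \<psi>) \<in> generic V" by metis
  have "(a, \<phi>) \<in> generic (U \<union> V)" "(b, \<psi>) \<in> generic (U \<union> V)"
    using U(3) V(3) generic_mono[of U "U \<union> V"] generic_mono[of V "U \<union> V"] by auto
  from ring_relation.mult[OF ring_relation_generic this] show ?case
    using U V by (meson finite_Un Un_least)
qed

lemma generic_local:
  assumes "(y, \<phi>) \<in> generic T" and "\<And>t. t \<in> T \<Longrightarrow> c t = c' t"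
  shows "\<phi> c = \<phi> c'"
  using assms(1) by (induction rule: generic_induct) (use assms(2) in auto)

lemma generic_polynomial:
  assumes "(y, \<phi>) \<in> generic T"
  shows "\<exists>r. \<forall>z. \<phi> (c(t := z)) = poly r z"
  using assms
proof (induction rule: generic_induct)
  case (const k)
  then show ?case by (intro exI[of _ "[:i2 k:]"]) simp
next
  case (var s)
  then show ?case
    by (intro exI[of _ "if s = t then [:0, 1:] else [:c s:]"]) simp
next
  case one
  then show ?case by (intro exI[of _ 1]) simp
next
  case (diff a \<phi> b \<psi>)
  then obtain r s where "\<And>z. \<phi> (c(t := z)) = poly r z" "\<And>z. \<psi> (c(t := z)) = poly s z" by blast
  then show ?case by (intro exI[of _ "r - s"]) (simp del: fun_upd_apply)
next
  case (mult a \<phi> b \<psi>)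
  then obtain r s where "\<And>z. \<phi> (c(t := z)) = poly r z" "\<And>z. \<psi> (c(t := z)) = poly s z" by blast
  then show ?case by (intro exI[of _ "r * s"]) (simp del: fun_upd_apply)
qed

lemma sum_fun_apply: "(sum f A) c = (\<Sum>j\<in>A. f j c)"
  by (induction A rule: infinite_finite_induct) auto

lemma power_fun_apply: "((f :: 'c \<Rightarrow> 'd::comm_ring_1) ^ n) c = f c ^ n"
  by (induction n) auto

text \<open>
  The coefficients do not depend on the coordinate \<open>x\<close>. Fixing the other coordinates gives a polynomial
  in one variable that vanishes on an infinite field.
\<close>

lemma generic_coefficients_0:
  assumes pq: "(p, q) \<in> poly_pairs (generic T)" and "x \<notin> T" and 0: "poly q (\<lambda>c. c x) = 0"
  shows "q = 0"
proof -
  have "coeff q n c = 0" for n c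
  proof -
    define r where "r = (\<Sum>j\<le>degree q. monom (coeff q j c) j)"
    have "poly r z = 0" for z
    proof -
      have "coeff q j c = coeff q j (c(x := z))" for j
        using generic_local[OF poly_pairsD[OF pq]] \<open>x \<notin> T\<close> by (metis fun_upd_other)
      then have "poly r z = poly q (\<lambda>c. c x) (c(x := z))"
        by (simp add: r_def poly_sum poly_monom poly_altdef[of q] sum_fun_apply power_fun_apply)
      then show ?thesis by (simp add: 0)
    qed
    then have "r = 0" using poly_roots_finite[of r] alg_closed_field_infinite by fastforce
    moreover have "coeff r n = coeff q n c"
      by (auto simp: r_def coeff_sum coeff_eq_0)
    ultimately show ?thesis by simp
  qed
  then show ?thesis by (intro poly_eqI) auto
qed

lemma generic_empty:
  assumes "(y, \<phi>) \<in> generic {}"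
  shows "\<exists>k. y = i1 k \<and> \<phi> = (\<lambda>c. i2 k)"
  using assms
proof (induction rule: generic_induct)
  case one
  show ?case using i1 i2 by (intro exI[of _ 1]) (auto simp: field_embedding_def)
next
  case (diff a \<phi> b \<psi>)
  then obtain k l where "a = i1 k" "\<phi> = (\<lambda>c. i2 k)" "b = i1 l" "\<psi> = (\<lambda>c. i2 l)" by blast
  then show ?case
    by (intro exI[of _ "k - l"]) (auto simp: field_embedding_diff[OF i1] field_embedding_diff[OF i2])
next
  case (mult a \<phi> b \<psi>)
  then obtain k l where "a = i1 k" "\<phi> = (\<lambda>c. i2 k)" "b = i1 l" "\<psi> = (\<lambda>c. i2 l)" by blast
  then show ?case using i1 i2
    by (intro exI[of _ "k * l"]) (auto simp: field_embedding_def)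
qed auto

text \<open>
  A polynomial that vanishes as a function on an infinite field is zero, hence so is its value in \<open>'f\<close>.
  The proof adds one variable at a time.
\<close>

lemma generic_vanishing:
  assumes "(y, 0) \<in> generic T"
  shows "y = 0"
proof -
  have "y = 0" if "finite U" "(y, 0) \<in> generic U" for U y
    using that
  proof (induction U arbitrary: y rule: finite_induct)
    case empty
    then obtain k where "y = i1 k" "0 = i2 k" using generic_empty[OF empty] by (metis zero_fun_apply)
    then show ?case by (metis field_embedding_eq_0_iff[OF i1] field_embedding_eq_0_iff[OF i2])
  next
    case (insert x U)
    have "(y, 0) \<in> adjoin (generic U) x (\<lambda>c. c x)"
      using insert.prems generic_insert by (rule subsetD[rotated])
    then obtain p q where pq: "(p, q) \<in> poly_pairs (generic U)"
      and y: "y = poly p x" and 0: "poly q (\<lambda>c. c x) = 0"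
      unfolding adjoin_def by (auto dest: sym)
    have "q = 0" using generic_coefficients_0[OF pq insert.hyps(2) 0] .
    then have "coeff p n = 0" for n
      using poly_pairsD[OF pq, of n] by (intro insert.IH) (simp only: coeff_0)
    then show ?case unfolding y by (simp add: poly_altdef)
  qed
  then show ?thesis using generic_finitary[OF assms] by blast
qed

lemma maximal_independent_exists:
  "\<exists>T \<subseteq> S. independent T \<and> (\<forall>x\<in>S. x \<notin> T \<longrightarrow> \<not> independent (insert x T))"
proof -
  define \<A> where "\<A> = {T. T \<subseteq> S \<and> independent T}"
  have "\<exists>M\<in>\<A>. \<forall>X\<in>\<A>. M \<subseteq> X \<longrightarrow> X = M"
  proof (rule subset_Zorn')
    fix C assume C: "subset.chain \<A> C"
    have "independent (\<Union>C)"
      unfolding independent_def single_valued_at_0_def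
    proof (intro allI impI)
      fix \<phi> assume \<phi>: "(0, \<phi>) \<in> generic (\<Union>C)"
      obtain U where U: "finite U" "U \<subseteq> \<Union>C" "(0, \<phi>) \<in> generic U"
        using generic_finitary[OF \<phi>] by blast
      show "\<phi> = 0"
      proof (cases "U = {}")
        case True
        with U(3) obtain k where k: "0 = i1 k" "\<phi> = (\<lambda>c. i2 k)" using generic_empty[of 0 \<phi>] by blast
        then have "k = 0" using field_embedding_eq_0_iff[OF i1, of k] by simp
        then show ?thesis using k(2) field_embedding_0[OF i2] by auto
      next
        case False
        then have "C \<noteq> {}" using U(2) by auto
        then obtain T where T: "T \<in> C" "U \<subseteq> T"
          using finite_subset_Union_chain[OF U(1,2) _ C] by blast
        then have "single_valued_at_0 (generic T)"
          using C by (auto simp: \<A>_def subset.chain_def independent_def)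
        then show ?thesis
          using U(3) generic_mono[OF T(2)] unfolding single_valued_at_0_def by blast
      qed
    qed
    then show "\<Union>C \<in> \<A>" using C by (auto simp: \<A>_def subset.chain_def)
  qed
  then obtain T where T: "T \<in> \<A>" and max: "\<And>X. X \<in> \<A> \<Longrightarrow> T \<subseteq> X \<Longrightarrow> X = T" by blast
  have "\<not> independent (insert x T)" if "x \<in> S" "x \<notin> T" for x
    using max[of "insert x T"] T that by (auto simp: \<A>_def)
  with T show ?thesis by (auto simp: \<A>_def)
qed

text \<open>
  The degree condition is the one of \<open>in_place_if_algebraic\<close>, and it survives evaluation at every
  point where the leading coefficient of \<open>q\<close> is nonzero. It holds because a coefficient of \<open>p\<close> beyond
  the degree of \<open>q\<close> is paired with the zero function.
\<close>

lemma dependent_algebraic: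
  assumes "independent T" and "\<not> independent (insert x T)"
  obtains p q where "(p, q) \<in> poly_pairs (generic T)" "q \<noteq> 0" "degree p \<le> degree q" "poly p x = 0"
proof -
  obtain \<phi> where \<phi>: "(0, \<phi>) \<in> generic (insert x T)" "\<phi> \<noteq> 0"
    using assms(2) unfolding independent_def single_valued_at_0_def by blast
  have "(0, \<phi>) \<in> adjoin (generic T) x (\<lambda>c. c x)"
    using \<phi>(1) generic_insert by (rule subsetD[rotated])
  then obtain p q where pq: "(p, q) \<in> poly_pairs (generic T)" "poly p x = 0" "\<phi> = poly q (\<lambda>c. c x)"
    unfolding adjoin_def by (auto dest: sym)
  have "coeff p n = 0" if "n > degree q" for n
    using poly_pairsD[OF pq(1), of n] that by (intro generic_vanishing) (simp only: coeff_eq_0)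
  then have "degree p \<le> degree q" by (simp add: degree_le)
  moreover have "q \<noteq> 0" using pq(3) \<phi>(2) by force
  ultimately show ?thesis using that pq by blast
qed

text \<open>
  The Nullstellensatz in the form needed here: some homomorphism over \<open>'k\<close> to the algebraically
  closed field \<open>'g\<close> is defined on all of \<open>S\<close>.
\<close>

theorem specialization:
  assumes few: "|S| <o |UNIV :: 'g set|"
  shows "\<exists>H. ring_relation H \<and> single_valued_at_0 H \<and> (\<forall>k. (i1 k, i2 k) \<in> H) \<and> (\<forall>x\<in>S. \<exists>y. (x, y) \<in> H)"
proof -
  obtain T where T: "T \<subseteq> S" "independent T" and max: "\<And>x. x \<in> S - T \<Longrightarrow> \<not> independent (insert x T)"
    using maximal_independent_exists[of S] by auto
  have "\<exists>p q. (p, q) \<in> poly_pairs (generic T) \<and> q \<noteq> 0 \<and> degree p \<le> degree q \<and> poly p x = 0"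
    if "x \<in> S - T" for x
    using dependent_algebraic[OF T(2) max[OF that]] by blast
  then obtain p q where pq: "\<And>x. x \<in> S - T \<Longrightarrow> (p x, q x) \<in> poly_pairs (generic T)"
    and q: "\<And>x. x \<in> S - T \<Longrightarrow> q x \<noteq> 0" and deg: "\<And>x. x \<in> S - T \<Longrightarrow> degree (p x) \<le> degree (q x)"
    and root: "\<And>x. x \<in> S - T \<Longrightarrow> poly (p x) x = 0" by metis
  define \<Phi> where "\<Phi> = (\<lambda>x. lead_coeff (q x)) ` (S - T)"
  have generic: "\<exists>y. (y, \<phi>) \<in> generic T" if "\<phi> \<in> \<Phi>" for \<phi>
    using that poly_pairsD[OF pq] unfolding \<Phi>_def by blast
  have "\<exists>c. \<forall>\<phi>\<in>\<Phi>. \<phi> c \<noteq> 0"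
  proof (rule common_nonzero[OF alg_closed_field_infinite])
    have "|\<Phi>| \<le>o |S|"
      unfolding \<Phi>_def by (meson Diff_subset card_of_image card_of_mono1 ordLeq_transitive)
    then show "|\<Phi>| <o |UNIV :: 'g set|" using few by (rule ordLeq_ordLess_trans)
  next
    fix \<phi> assume "\<phi> \<in> \<Phi>"
    then show "\<exists>U. finite U \<and> (\<forall>c c'. (\<forall>t\<in>U. c t = c' t) \<longrightarrow> \<phi> c = \<phi> c')"
      using generic generic_finitary generic_local by metis
  next
    fix \<phi> c t assume "\<phi> \<in> \<Phi>"
    then show "\<exists>r. \<forall>z. \<phi> (c(t := z)) = poly r z" using generic generic_polynomial by metis
  next
    fix \<phi> assume "\<phi> \<in> \<Phi>"
    then have "\<phi> \<noteq> 0" using q by (auto simp: \<Phi>_def)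
    then show "\<exists>c. \<phi> c \<noteq> 0" by (auto simp: fun_eq_iff)
  qed
  then obtain c where c: "\<And>x. x \<in> S - T \<Longrightarrow> lead_coeff (q x) c \<noteq> 0" by (auto simp: \<Phi>_def)
  \<comment> \<open>Evaluation at \<open>c\<close>, well-defined because \<open>T\<close> is independent.\<close>
  define H0 where "H0 = {(y, \<phi> c) | y \<phi>. (y, \<phi>) \<in> generic T}"
  have H0I: "(y, \<phi> c) \<in> H0" if "(y, \<phi>) \<in> generic T" for y \<phi>
    using that unfolding H0_def by blast
  interpret G: ring_relation "generic T" by (rule ring_relation_generic)
  have "ring_relation H0"
  proof
    show "(1, 1) \<in> H0" using H0I[OF G.one] by simp
  next
    fix a b a' b' assume "(a, b) \<in> H0" "(a', b') \<in> H0"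
    then obtain \<phi> \<psi> where *: "(a, \<phi>) \<in> generic T" "(a', \<psi>) \<in> generic T" and "b = \<phi> c" "b' = \<psi> c"
      unfolding H0_def by blast
    then show "(a - a', b - b') \<in> H0" "(a * a', b * b') \<in> H0"
      using H0I[OF G.diff[OF *]] H0I[OF G.mult[OF *]] by simp_all
  qed
  moreover have "single_valued_at_0 H0"
    unfolding single_valued_at_0_def
  proof (intro allI impI)
    fix b assume "(0, b) \<in> H0"
    then obtain \<phi> where "(0, \<phi>) \<in> generic T" "b = \<phi> c" unfolding H0_def by blast
    moreover from this(1) have "\<phi> = 0"
      using T(2) unfolding independent_def single_valued_at_0_def by blast
    ultimately show "b = 0" by simp
  qed
  ultimately obtain H where H: "H0 \<subseteq> H" "maximal_place H"
    using maximal_place_exists by blast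
  interpret maximal_place H by (rule H(2))
  have "(i1 k, i2 k) \<in> H0" for k
    by (rule H0I) (auto simp: generic_def intro: ring_generated.base)
  moreover have "\<exists>y. (x, y) \<in> H" if "x \<in> S" for x
  proof (cases "x \<in> T")
    case True
    then have "(x, c x) \<in> H0"
      by (intro H0I) (auto simp: generic_def intro: ring_generated.base)
    then show ?thesis using H(1) by auto
  next
    case False
    with that have x: "x \<in> S - T" by simp
    define q' where "q' = map_poly (\<lambda>\<phi>. \<phi> c) (q x)"
    have coeff: "coeff q' n = coeff (q x) n c" for n by (simp add: q'_def coeff_map_poly)
    have "(p x, q') \<in> poly_pairs H"
      using H0I[OF poly_pairsD[OF pq[OF x]]] H(1) by (auto simp: poly_pairs_def coeff)
    moreover have "coeff q' (degree (q x)) \<noteq> 0" using c[OF x] by (simp add: coeff)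
    then have "q' \<noteq> 0" "degree (p x) \<le> degree q'"
      using deg[OF x] by (auto dest: le_degree)
    ultimately show ?thesis using root[OF x] in_place_if_algebraic by blast
  qed
  ultimately show ?thesis
    using H(1) ring_relation_axioms single_valued by (auto simp: single_valued_at_0_def)
qed

end


section \<open>Linear extension on finitely supported functions\<close>

abbreviation "lookup \<equiv> Poly_Mapping.lookup"
abbreviation "keys \<equiv> Poly_Mapping.keys"
abbreviation "single \<equiv> Poly_Mapping.single"

abbreviation scal :: "'f::field \<Rightarrow> ('e \<Rightarrow>\<^sub>0 'f) \<Rightarrow> ('e \<Rightarrow>\<^sub>0 'f)" where
  "scal c \<equiv> Poly_Mapping.map ((*) c)"

lemma lookup_map_0: "f 0 = 0 \<Longrightarrow> lookup (Poly_Mapping.map f v) e = f (lookup v e)"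
  by (simp add: map.rep_eq when_def)

lemma lookup_scal [simp]: "lookup (scal c v) e = c * lookup v e"
  by (simp add: lookup_map_0)

lemma keys_map_subset: "keys (Poly_Mapping.map f v) \<subseteq> keys v"
  by (auto simp: in_keys_iff Poly_Mapping.map.rep_eq when_def)

lemma keys_map_le: "keys v \<subseteq> S \<Longrightarrow> keys (Poly_Mapping.map f v) \<subseteq> S"
  using keys_map_subset by (rule order_trans)

lemma keys_add_le: "keys v \<subseteq> S \<Longrightarrow> keys w \<subseteq> S \<Longrightarrow> keys (v + w) \<subseteq> S"
  using keys_add[of v w] by blast

lemma scal_simps:
  "scal c (v + w) = scal c v + scal c w" "scal c (v - w) = scal c v - scal c w"
  "scal (c + d) v = scal c v + scal d v" "scal (c - d) v = scal c v - scal d v"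
  "scal c (scal d v) = scal (c * d) v" "scal c 0 = 0" "scal 0 v = 0" "scal 1 v = v"
  "scal c (single e d) = single e (c * d)"
  by (auto intro!: poly_mapping_eqI simp: lookup_add lookup_minus algebra_simps lookup_single when_def)

lemma scal_sum: "scal c (sum f A) = (\<Sum>x\<in>A. scal c (f x))"
  by (induction A rule: infinite_finite_induct) (auto simp: scal_simps)

text \<open>
  The linear map that sends the basis vector at \<open>e\<close> to \<open>B e\<close>; equivalently, multiplication of the row
  vector \<open>v\<close> by the matrix with rows \<open>B e\<close>.
\<close>

definition lin :: "('e \<Rightarrow> ('d \<Rightarrow>\<^sub>0 'f)) \<Rightarrow> ('e \<Rightarrow>\<^sub>0 'f::field) \<Rightarrow> ('d \<Rightarrow>\<^sub>0 'f)" where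
  "lin B v = (\<Sum>e\<in>keys v. scal (lookup v e) (B e))"

lemma lin_eq_sum:
  assumes "finite S" and "keys v \<subseteq> S"
  shows "lin B v = (\<Sum>e\<in>S. scal (lookup v e) (B e))"
  unfolding lin_def using assms
  by (intro sum.mono_neutral_left) (auto simp: scal_simps in_keys_iff)

lemma lin_cong: "(\<And>e. e \<in> keys v \<Longrightarrow> B e = C e) \<Longrightarrow> lin B v = lin C v"
  by (simp add: lin_def)

lemma lin_add: "lin B (v + w) = lin B v + lin B w"
proof -
  let ?S = "keys v \<union> keys w"
  have "lin B u = (\<Sum>e\<in>?S. scal (lookup u e) (B e))" if "keys u \<subseteq> ?S" for u
    using that by (intro lin_eq_sum) auto
  moreover have "keys (v + w) \<subseteq> ?S" by (rule keys_add)
  ultimately show ?thesis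
    by (simp add: lookup_add scal_simps sum.distrib)
qed

lemma lin_0 [simp]: "lin B 0 = 0"
  by (simp add: lin_def)

lemma lin_scal: "lin B (scal c v) = scal c (lin B v)"
proof -
  have "lin B (scal c v) = (\<Sum>e\<in>keys v. scal (lookup (scal c v) e) (B e))"
    by (intro lin_eq_sum finite_keys keys_map_subset)
  then show ?thesis by (simp add: lin_def scal_sum scal_simps)
qed

lemma lin_diff: "lin B (v - w) = lin B v - lin B w"
  using lin_add[of B "v - w" w] by (simp add: algebra_simps)

lemma lin_sum: "lin B (sum f A) = (\<Sum>x\<in>A. lin B (f x))"
  by (induction A rule: infinite_finite_induct) (auto simp: lin_add)

lemma lin_single: "lin B (single e c) = scal c (B e)"
  by (cases "c = 0") (auto simp: lin_def scal_simps)

lemma lin_lin: "lin C (lin B v) = lin (\<lambda>e. lin C (B e)) v"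
  by (simp add: lin_def[of B] lin_sum lin_scal) (simp add: lin_def)

lemma lin_diff_fun: "lin (\<lambda>e. B e - C e) v = lin B v - lin C v"
  by (simp add: lin_def scal_simps sum_subtractf)

lemma lin_0_fun: "lin (\<lambda>e. 0) v = 0"
  by (simp add: lin_def scal_simps)

lemma lin_scal_fun: "lin (\<lambda>e. scal c (B e)) v = scal c (lin B v)"
  by (simp add: lin_def scal_sum scal_simps mult.commute)

lemma lin_swap: "lin (\<lambda>e. lin (\<lambda>d. M e d) w) v = lin (\<lambda>d. lin (\<lambda>e. M e d) v) w"
  unfolding lin_def scal_sum by (subst sum.swap) (simp add: scal_simps mult.commute)

lemma lin_single_id: "lin (\<lambda>e. single e 1) v = v"
proof (rule poly_mapping_eqI)
  fix d show "lookup (lin (\<lambda>e. single e 1) v) d = lookup v d"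
    by (auto simp: lin_def lookup_sum lookup_single when_def in_keys_iff)
qed

lemma keys_lin_subset:
  assumes "\<And>e. e \<in> keys v \<Longrightarrow> keys (B e) \<subseteq> S"
  shows "keys (lin B v) \<subseteq> S"
  unfolding lin_def using assms keys_sum[of "\<lambda>e. scal (lookup v e) (B e)" "keys v"] keys_map_subset
  by fast

text \<open>
  Linearity is only required on the vectors supported in \<open>S\<close>, since the isomorphisms in question are
  given on such vectors alone.
\<close>

lemma linear_eq_lin:
  assumes add: "\<And>v w. keys v \<subseteq> S \<Longrightarrow> keys w \<subseteq> S \<Longrightarrow> L (v + w) = L v + L w"
    and scal: "\<And>c v. keys v \<subseteq> S \<Longrightarrow> L (scal c v) = scal c (L v)"
    and v: "keys v \<subseteq> S"
  shows "L v = lin (\<lambda>e. L (single e 1)) v"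
proof -
  have "L 0 = 0" using scal[of 0 0] by (simp add: scal_simps)
  have "L (\<Sum>e\<in>J. single e (lookup v e)) =
      (\<Sum>e\<in>J. scal (lookup v e) (L (single e 1)))
      \<and> keys (\<Sum>e\<in>J. single e (lookup v e)) \<subseteq> S" if "finite J" "J \<subseteq> S" for J
    using that
  proof (induction J rule: finite_induct)
    case empty
    then show ?case using \<open>L 0 = 0\<close> by simp
  next
    case (insert e J)
    have e: "keys (single e (lookup v e)) \<subseteq> S"
      "keys (single e 1) \<subseteq> S" using insert.prems by auto
    have "L (single e (lookup v e)) = scal (lookup v e) (L (single e 1))"
      using scal[OF e(2), of "lookup v e"] by (simp add: scal_simps)
    moreover have IH: "keys (\<Sum>e\<in>J. single e (lookup v e)) \<subseteq> S"
      "L (\<Sum>e\<in>J. single e (lookup v e)) = (\<Sum>e\<in>J. scal (lookup v e) (L (single e 1)))"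
      using insert.IH insert.prems by auto
    moreover have "keys (single e (lookup v e) + (\<Sum>e\<in>J. single e (lookup v e))) \<subseteq> S"
      using keys_add[of "single e (lookup v e)" "\<Sum>e\<in>J. single e (lookup v e)"] e(1) IH(1) by auto
    ultimately show ?case
      using add[OF e(1) IH(1)] insert.hyps by simp
  qed
  from this[OF finite_keys v]
  have "L (\<Sum>e\<in>keys v. single e (lookup v e)) = lin (\<lambda>e. L (single e 1)) v"
    by (simp add: lin_def)
  moreover have "(\<Sum>e\<in>keys v. single e (lookup v e)) = v"
    using lin_single_id[of v] by (simp add: lin_def scal_simps)
  ultimately show ?thesis by simp
qed


section \<open>Isomorphism of algebra structures\<close>

lemma algebra_isomorphic_trans:
  assumes "algebra_isomorphic S T" and "algebra_isomorphic T U"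
  shows "algebra_isomorphic S U"
proof -
  obtain h where h: "bij_betw h (alg_carrier S) (alg_carrier T)"
    "\<And>x y. x \<in> alg_carrier S \<Longrightarrow> y \<in> alg_carrier S \<Longrightarrow> h (alg_add S x y) = alg_add T (h x) (h y)"
    "\<And>c x. x \<in> alg_carrier S \<Longrightarrow> h (alg_scale S c x) = alg_scale T c (h x)"
    "\<And>x y. x \<in> alg_carrier S \<Longrightarrow> y \<in> alg_carrier S \<Longrightarrow> h (alg_mult S x y) = alg_mult T (h x) (h y)"
    using assms(1) unfolding algebra_isomorphic_def by metis
  obtain g where g: "bij_betw g (alg_carrier T) (alg_carrier U)"
    "\<And>x y. x \<in> alg_carrier T \<Longrightarrow> y \<in> alg_carrier T \<Longrightarrow> g (alg_add T x y) = alg_add U (g x) (g y)"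
    "\<And>c x. x \<in> alg_carrier T \<Longrightarrow> g (alg_scale T c x) = alg_scale U c (g x)"
    "\<And>x y. x \<in> alg_carrier T \<Longrightarrow> y \<in> alg_carrier T \<Longrightarrow> g (alg_mult T x y) = alg_mult U (g x) (g y)"
    using assms(2) unfolding algebra_isomorphic_def by metis
  have "h x \<in> alg_carrier T" if "x \<in> alg_carrier S" for x
    using h(1) that by (rule bij_betwE[rule_format])
  then show ?thesis
    unfolding algebra_isomorphic_def
    by (intro exI[of _ "g \<circ> h"] conjI bij_betw_trans[OF h(1) g(1)]) (auto simp: h g)
qed

definition closed_algebra :: "('f, 's) algebra_structure \<Rightarrow> bool" where
  "closed_algebra S \<longleftrightarrow>
     (\<forall>x\<in>alg_carrier S. \<forall>y\<in>alg_carrier S. alg_add S x y \<in> alg_carrier S \<and> alg_mult S x y \<in> alg_carrier S) \<and>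
     (\<forall>c. \<forall>x\<in>alg_carrier S. alg_scale S c x \<in> alg_carrier S)"

lemma algebra_isomorphic_sym:
  assumes iso: "algebra_isomorphic S T" and closed: "closed_algebra S"
  shows "algebra_isomorphic T S"
proof -
  obtain h where h: "bij_betw h (alg_carrier S) (alg_carrier T)"
    "\<And>x y. x \<in> alg_carrier S \<Longrightarrow> y \<in> alg_carrier S \<Longrightarrow> h (alg_add S x y) = alg_add T (h x) (h y)"
    "\<And>c x. x \<in> alg_carrier S \<Longrightarrow> h (alg_scale S c x) = alg_scale T c (h x)"
    "\<And>x y. x \<in> alg_carrier S \<Longrightarrow> y \<in> alg_carrier S \<Longrightarrow> h (alg_mult S x y) = alg_mult T (h x) (h y)"
    using iso unfolding algebra_isomorphic_def by metis
  define g where "g = inv_into (alg_carrier S) h"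
  have gh: "g (h x) = x" if "x \<in> alg_carrier S" for x
    unfolding g_def using h(1) that by (rule bij_betw_inv_into_left)
  have ex: "\<exists>x\<in>alg_carrier S. y = h x" if "y \<in> alg_carrier T" for y
    using h(1) that unfolding bij_betw_def by blast
  have bij: "bij_betw g (alg_carrier T) (alg_carrier S)"
    unfolding g_def using h(1) by (rule bij_betw_inv_into)
  have "g (alg_add T x y) = alg_add S (g x) (g y) \<and> g (alg_mult T x y) = alg_mult S (g x) (g y)"
    if x: "x \<in> alg_carrier T" and y: "y \<in> alg_carrier T" for x y
  proof -
    obtain x' y' where "x' \<in> alg_carrier S" "x = h x'" "y' \<in> alg_carrier S" "y = h y'"
      using ex[OF x] ex[OF y] by blast
    then show ?thesis using closed gh h(2,4)[symmetric] by (simp add: closed_algebra_def)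
  qed
  moreover have "g (alg_scale T c x) = alg_scale S c (g x)" if x: "x \<in> alg_carrier T" for c x
  proof -
    obtain x' where "x' \<in> alg_carrier S" "x = h x'"
      using ex[OF x] by blast
    then show ?thesis using closed gh h(3)[symmetric] by (simp add: closed_algebra_def)
  qed
  ultimately show ?thesis
    unfolding algebra_isomorphic_def using bij by blast
qed


section \<open>Base change in coordinates\<close>

locale based_algebra = nonassoc_algebra scale mul
  for scale :: "'k::field \<Rightarrow> 'a::ab_group_add \<Rightarrow> 'a" and mul :: "'a \<Rightarrow> 'a \<Rightarrow> 'a" +
  fixes E :: "'a set" and i :: "'k \<Rightarrow> 'f::field"
  assumes independent: "\<not> dependent E" and spanning: "span E = UNIV"
    and embedding: "field_embedding i"
begin

lemma i_simps [simp]: "i 0 = 0" "i 1 = 1" "i (x + y) = i x + i y" "i (x * y) = i x * i y"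
  using embedding field_embedding_0[of i] by (auto simp: field_embedding_def)

definition coord :: "'a \<Rightarrow> ('a \<Rightarrow>\<^sub>0 'f)" where
  "coord a = Abs_poly_mapping (\<lambda>e. i (representation E a e))"

lemma lookup_coord: "lookup (coord a) e = i (representation E a e)"
proof -
  have "{e. i (representation E a e) \<noteq> 0} \<subseteq> {e. representation E a e \<noteq> 0}" by auto
  then have "finite {e. i (representation E a e) \<noteq> 0}"
    using finite_representation finite_subset by blast
  then show ?thesis by (simp add: coord_def)
qed

lemma keys_coord: "keys (coord a) \<subseteq> E"
proof
  fix e assume "e \<in> keys (coord a)"
  then have "representation E a e \<noteq> 0" by (auto simp: in_keys_iff lookup_coord)
  then show "e \<in> E" by (rule representation_ne_zero)
qed

lemma coord_add: "coord (a + b) = coord a + coord b"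
  by (intro poly_mapping_eqI)
    (simp add: lookup_coord lookup_add representation_add independent spanning)

lemma coord_scale: "coord (scale c a) = scal (i c) (coord a)"
  by (intro poly_mapping_eqI)
    (simp add: lookup_coord representation_scale independent spanning)

lemma coord_basis: "e \<in> E \<Longrightarrow> coord e = single e 1"
  by (intro poly_mapping_eqI)
    (simp add: lookup_coord representation_basis independent lookup_single when_def)

text \<open>
  A semilinear map on the algebra is determined by its values on the basis, which the coordinates
  recombine.
\<close>

lemma semilinear_eq_lin_coord:
  assumes add: "\<And>x y. T (x + y) = T x + T y" and scale: "\<And>c x. T (scale c x) = scal (i c) (T x)"
  shows "T a = lin T (coord a)"
proof -
  have "a \<in> span E" by (simp add: spanning)
  then show ?thesis
  proof (induction rule: span_induct_alt)
    case base
    show ?case using scale[of 0 0] coord_scale[of 0 0] by (simp add: scal_simps)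
  next
    case (step c x y)
    then show ?case
      by (simp add: add scale coord_add coord_scale coord_basis lin_add lin_scal lin_single scal_simps)
  qed
qed

text \<open>
  The bilinear extension of the multiplication table of the basis. Only the products of basis elements
  enter, and their coordinates come from the ground field.
\<close>

definition model_mult :: "('a \<Rightarrow>\<^sub>0 'f) \<Rightarrow> ('a \<Rightarrow>\<^sub>0 'f) \<Rightarrow> ('a \<Rightarrow>\<^sub>0 'f)" where
  "model_mult v w = lin (\<lambda>e. lin (\<lambda>d. coord (mul e d)) w) v"

definition model :: "('f, 'a \<Rightarrow>\<^sub>0 'f) algebra_structure" where
  "model = \<lparr> alg_carrier = {v. keys v \<subseteq> E}, alg_add = (+), alg_scale = scal, alg_mult = model_mult \<rparr>"

lemma model_mult_diff:
  "model_mult (v - v') w = model_mult v w - model_mult v' w"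
  "model_mult v (w - w') = model_mult v w - model_mult v w'"
  by (simp_all add: model_mult_def lin_diff lin_diff_fun)

lemma model_mult_0: "model_mult 0 w = 0" "model_mult v 0 = 0"
  by (simp_all add: model_mult_def lin_0_fun)

lemma model_mult_scal: "model_mult (scal c v) (scal d w) = scal (c * d) (model_mult v w)"
  by (simp add: model_mult_def lin_scal lin_scal_fun scal_simps mult.commute)

lemma model_mult_coord: "model_mult (coord a) (coord b) = coord (mul a b)"
proof -
  have "coord (mul e b) = lin (\<lambda>d. coord (mul e d)) (coord b)" for e
    by (rule semilinear_eq_lin_coord) (simp_all add: mult_add_right mult_scale_right coord_add coord_scale)
  moreover have "coord (mul a b) = lin (\<lambda>e. coord (mul e b)) (coord a)"
    by (rule semilinear_eq_lin_coord) (simp_all add: mult_add_left mult_scale_left coord_add coord_scale)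
  ultimately show ?thesis by (simp add: model_mult_def)
qed

lemma keys_model_mult: "keys (model_mult v w) \<subseteq> E"
  unfolding model_mult_def by (intro keys_lin_subset keys_coord)

lemma closed_model: "closed_algebra model"
  unfolding closed_algebra_def model_def
  by (simp add: keys_model_mult keys_map_le keys_add_le)

abbreviation rel where "rel \<equiv> tensor_relations scale (\<lambda>c f. i c * f)"

text \<open>
  The map \<open>a \<otimes> f \<mapsto> f a\<close> on representatives, in coordinates. The lemmas below show that its kernel
  consists exactly of the tensor relations, so that it identifies the base change with the model.
\<close>

definition tensor_coord :: "(('a \<times> 'f) \<Rightarrow>\<^sub>0 int) \<Rightarrow> ('a \<Rightarrow>\<^sub>0 'f)" where
  "tensor_coord p = lin (\<lambda>(a, f). scal f (coord a)) (Poly_Mapping.map of_int p)"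

lemma tensor_coord_0 [simp]: "tensor_coord 0 = 0"
proof -
  have "Poly_Mapping.map of_int 0 = (0 :: ('a \<times> 'f) \<Rightarrow>\<^sub>0 'f)"
    by (intro poly_mapping_eqI) (simp add: lookup_map_0)
  then show ?thesis by (simp add: tensor_coord_def)
qed

lemma tensor_coord_of: "tensor_coord (frag_of (a, f)) = scal f (coord a)"
  by (simp add: tensor_coord_def lin_single scal_simps)

lemma tensor_coord_diff: "tensor_coord (p - q) = tensor_coord p - tensor_coord q"
proof -
  have "Poly_Mapping.map of_int (p - q) =
      (Poly_Mapping.map of_int p - Poly_Mapping.map of_int q :: ('a \<times> 'f) \<Rightarrow>\<^sub>0 'f)"
    by (intro poly_mapping_eqI) (simp add: lookup_map_0 lookup_minus)
  then show ?thesis by (simp add: tensor_coord_def lin_diff)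
qed

lemma tensor_coord_add: "tensor_coord (p + q) = tensor_coord p + tensor_coord q"
  using tensor_coord_diff[of "p + q" q] by (simp add: algebra_simps)

lemma tensor_coord_sum: "tensor_coord (sum f A) = (\<Sum>x\<in>A. tensor_coord (f x))"
  by (induction A rule: infinite_finite_induct) (auto simp: tensor_coord_add)

lemma keys_tensor_coord: "keys (tensor_coord p) \<subseteq> E"
  unfolding tensor_coord_def using keys_coord keys_map_subset
  by (intro keys_lin_subset) fastforce

lemma tensor_coord_relations: "p \<in> rel \<Longrightarrow> tensor_coord p = 0"
  by (induction rule: tensor_relations.induct)
    (simp_all add: tensor_coord_diff tensor_coord_of coord_add coord_scale scal_simps mult.commute)

lemma tensor_coord_scale: "tensor_coord (free_scale g p) = scal g (tensor_coord p)"
proof (induction p rule: frag_induction[OF subset_UNIV])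
  case (2 u)
  then show ?case by (cases u) (simp add: free_scale_def tensor_coord_of scal_simps)
qed (simp_all add: free_scale_def frag_extend_diff tensor_coord_diff scal_simps)

lemma tensor_coord_mult: "tensor_coord (free_mult mul p q) = model_mult (tensor_coord p) (tensor_coord q)"
proof (induction p rule: frag_induction[OF subset_UNIV])
  case (2 u)
  obtain a f where u: "u = (a, f)" by fastforce
  show ?case unfolding u
  proof (induction q rule: frag_induction[OF subset_UNIV])
    case (2 v)
    then show ?case
      by (cases v) (simp add: free_mult_of tensor_coord_of model_mult_scal model_mult_coord)
  qed (simp_all add: free_mult_diff_right tensor_coord_diff model_mult_diff model_mult_0)
qed (simp_all add: free_mult_diff_left tensor_coord_diff model_mult_diff model_mult_0)

text \<open>
  A section of \<open>tensor_coord\<close>. It is additive modulo the tensor relations only, because a coordinate of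
  a sum is expanded as a single tensor.
\<close>

definition tensor_of :: "('a \<Rightarrow>\<^sub>0 'f) \<Rightarrow> (('a \<times> 'f) \<Rightarrow>\<^sub>0 int)" where
  "tensor_of v = (\<Sum>e\<in>keys v. frag_of (e, lookup v e))"

lemma tensor_coord_tensor_of:
  assumes "keys v \<subseteq> E"
  shows "tensor_coord (tensor_of v) = v"
proof -
  have "tensor_coord (tensor_of v) = lin (\<lambda>e. single e 1) v"
    using assms unfolding tensor_of_def lin_def tensor_coord_sum
    by (intro sum.cong) (auto simp: tensor_coord_of coord_basis)
  then show ?thesis by (simp add: lin_single_id)
qed

lemma relations_sum: "(\<And>x. x \<in> J \<Longrightarrow> f x \<in> rel) \<Longrightarrow> sum f J \<in> rel"
  by (induction J rule: infinite_finite_induct) (auto intro: tensor_relations_zero tensor_relations_add)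

lemma frag_of_0_relation: "frag_of (x, 0) \<in> rel"
  using tensor_relations_uminus[OF tensor_relations.add_right[of x 0 0 scale "\<lambda>c f. i c * f"]] by simp

lemma tensor_of_superset:
  assumes "finite J" and "keys v \<subseteq> J"
  shows "(\<Sum>e\<in>J. frag_of (e, lookup v e)) - tensor_of v \<in> rel"
proof -
  have "(\<Sum>e\<in>J. frag_of (e, lookup v e)) - tensor_of v = (\<Sum>e\<in>J - keys v. frag_of (e, lookup v e))"
    unfolding tensor_of_def using assms by (simp add: sum_diff)
  also have "\<dots> \<in> rel"
    by (intro relations_sum) (auto simp: in_keys_iff frag_of_0_relation)
  finally show ?thesis .
qed

lemma tensor_of_add: "tensor_of (v + w) - tensor_of v - tensor_of w \<in> rel"
proof -
  let ?J = "keys v \<union> keys w"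
  define T where "T u = (\<Sum>e\<in>?J. frag_of (e, lookup u e))" for u :: "'a \<Rightarrow>\<^sub>0 'f"
  have T: "T u - tensor_of u \<in> rel" if "keys u \<subseteq> ?J" for u
    unfolding T_def using that by (intro tensor_of_superset) auto
  have "T (v + w) - T v - T w = (\<Sum>e\<in>?J. frag_of (e, lookup v e + lookup w e)
      - frag_of (e, lookup v e) - frag_of (e, lookup w e))"
    by (simp add: T_def sum_subtractf lookup_add)
  also have "\<dots> \<in> rel" by (intro relations_sum tensor_relations.add_right)
  finally have "T (v + w) - T v - T w \<in> rel" .
  moreover have "keys (v + w) \<subseteq> ?J" by (rule keys_add)
  then have "(T (v + w) - tensor_of (v + w)) - (T v - tensor_of v) - (T w - tensor_of w) \<in> rel"
    by (intro tensor_relations.diff T) auto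
  ultimately have "(T (v + w) - T v - T w) -
      ((T (v + w) - tensor_of (v + w)) - (T v - tensor_of v) - (T w - tensor_of w)) \<in> rel"
    by (rule tensor_relations.diff)
  then show ?thesis by (simp add: algebra_simps)
qed

text \<open>
  Expand \<open>a\<close> in the basis and move the scalars across the tensor sign.
\<close>

lemma tensor_of_coord: "frag_of (a, f) - tensor_of (scal f (coord a)) \<in> rel"
proof -
  have "a \<in> span E" by (simp add: spanning)
  then show ?thesis
  proof (induction arbitrary: f rule: span_induct_alt)
    case base
    have "coord 0 = 0" using coord_scale[of 0 0] by (simp add: scal_simps)
    moreover have "frag_of (0, f) \<in> rel"
      using tensor_relations_uminus[OF tensor_relations.add_left[of 0 0 f scale "\<lambda>c f. i c * f"]] by simp
    ultimately show ?case by (simp add: scal_simps tensor_of_def)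
  next
    case (step c x y)
    let ?u = "scal f (coord (scale c x))" and ?v = "scal f (coord y)"
    have u: "?u = single x (i c * f)"
      using step by (simp add: coord_scale coord_basis scal_simps mult.commute)
    have "frag_of (x, i c * f) - tensor_of ?u \<in> rel"
      unfolding u by (cases "i c * f = 0") (auto simp: tensor_of_def frag_of_0_relation tensor_relations_zero)
    from tensor_relations_add[OF tensor_relations.balanced[of scale c x f "\<lambda>c f. i c * f"] this]
    have u_rel: "frag_of (scale c x, f) - tensor_of ?u \<in> rel" by simp
    have sum: "scal f (coord (scale c x + y)) = ?u + ?v" by (simp add: coord_add scal_simps)
    from tensor_relations_add[OF u_rel step.IH]
    have "frag_of (scale c x, f) - tensor_of ?u + (frag_of (y, f) - tensor_of ?v) \<in> rel" .
    from tensor_relations.diff[OF tensor_relations_add[OF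
        tensor_relations.add_left[of "scale c x" y f scale "\<lambda>c f. i c * f"] this] tensor_of_add[of ?u ?v]]
    show ?case unfolding sum by (simp add: add_diff_eq diff_add_eq diff_diff_eq2)
  qed
qed

text \<open>
  Every tensor is congruent to one in normal form, so a tensor with vanishing coordinates is zero.
\<close>

lemma tensor_of_tensor_coord: "p - tensor_of (tensor_coord p) \<in> rel"
proof (induction p rule: frag_induction[OF subset_UNIV])
  case 1
  then show ?case by (simp add: tensor_of_def tensor_relations_zero)
next
  case (2 u)
  then show ?case by (cases u) (simp add: tensor_coord_of tensor_of_coord)
next
  case (3 p q)
  let ?v = "tensor_coord (p - q)" and ?w = "tensor_coord q"
  have "tensor_of (tensor_coord p) - tensor_of ?v - tensor_of ?w \<in> rel"
    using tensor_of_add[of ?v ?w] by (simp add: tensor_coord_diff)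
  from tensor_relations_add[OF tensor_relations.diff[OF 3] this]
  show ?case by (simp add: algebra_simps)
qed

lemma tensor_equiv_iff: "(p, q) \<in> tensor_equiv scale (\<lambda>c f. i c * f) \<longleftrightarrow> tensor_coord p = tensor_coord q"
proof
  assume "(p, q) \<in> tensor_equiv scale (\<lambda>c f. i c * f)"
  then have "tensor_coord (p - q) = 0" by (intro tensor_coord_relations) (simp add: tensor_equiv_def)
  then show "tensor_coord p = tensor_coord q" by (simp add: tensor_coord_diff)
next
  assume "tensor_coord p = tensor_coord q"
  with tensor_relations.diff[OF tensor_of_tensor_coord[of p] tensor_of_tensor_coord[of q]]
  have "p - q \<in> rel" by simp
  then show "(p, q) \<in> tensor_equiv scale (\<lambda>c f. i c * f)" by (simp add: tensor_equiv_def)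
qed

theorem model_isomorphic_base_change: "algebra_isomorphic model (base_change scale mul i)"
proof -
  let ?r = "tensor_equiv scale (\<lambda>c f. i c * f)"
  define h where "h v = ?r `` {tensor_of v}" for v
  have class_eq: "?r `` {p} = ?r `` {q} \<longleftrightarrow> tensor_coord p = tensor_coord q" for p q
    using eq_equiv_class_iff[OF equiv_tensor_equiv] tensor_equiv_iff by fastforce
  have carrier: "alg_carrier (base_change scale mul i) = UNIV // ?r"
    by (simp add: base_change_def Let_def)
  have "bij_betw h {v. keys v \<subseteq> E} (UNIV // ?r)"
    unfolding bij_betw_def
  proof
    show "inj_on h {v. keys v \<subseteq> E}"
      by (auto intro!: inj_onI simp: h_def class_eq tensor_coord_tensor_of)
    show "h ` {v. keys v \<subseteq> E} = UNIV // ?r"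
    proof
      show "h ` {v. keys v \<subseteq> E} \<subseteq> UNIV // ?r" by (auto simp: h_def quotient_def)
      show "UNIV // ?r \<subseteq> h ` {v. keys v \<subseteq> E}"
      proof
        fix X assume "X \<in> UNIV // ?r"
        then obtain p where "X = ?r `` {p}" by (auto simp: quotient_def)
        also have "\<dots> = h (tensor_coord p)"
          by (simp add: h_def class_eq tensor_coord_tensor_of keys_tensor_coord)
        finally show "X \<in> h ` {v. keys v \<subseteq> E}" using keys_tensor_coord by blast
      qed
    qed
  qed
  then show ?thesis
    unfolding algebra_isomorphic_def carrier
    by (intro exI[of _ h])
      (simp add: model_def h_def base_change_add base_change_scale base_change_mult class_eq
        tensor_coord_tensor_of tensor_coord_add tensor_coord_scale tensor_coord_mult keys_model_mult
        keys_map_le keys_add_le)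
qed

end


section \<open>Transfer of isomorphisms\<close>

text \<open>
  For a graph \<open>H\<close> of a homomorphism, \<open>w\<close> is the image of \<open>v\<close> under its entrywise application. All
  operations of the model preserve this relation, and \<open>w\<close> is determined by \<open>v\<close>, so identities between
  vectors over the first field are inherited by their images.
\<close>

definition related :: "('f::zero \<times> 'g::zero) set \<Rightarrow> ('e \<Rightarrow>\<^sub>0 'f) \<Rightarrow> ('e \<Rightarrow>\<^sub>0 'g) \<Rightarrow> bool" where
  "related H v w \<longleftrightarrow> (\<forall>e. (lookup v e, lookup w e) \<in> H)"

context ring_relation begin

lemma related_single: "related H (single e 1) (single e 1)"
  using one zero by (simp add: related_def lookup_single when_def)

end

lemma related_lin:
  assumes H: "ring_relation H" and v: "related H v v'" and keys: "keys v \<subseteq> S" "keys v' \<subseteq> S"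
    and B: "\<And>e. e \<in> S \<Longrightarrow> related H (B e) (B' e)"
  shows "related H (lin B v) (lin B' v')"
proof -
  interpret ring_relation H by (rule H)
  let ?J = "keys v \<union> keys v'"
  have "lin B v = (\<Sum>e\<in>?J. scal (lookup v e) (B e))" "lin B' v' = (\<Sum>e\<in>?J. scal (lookup v' e) (B' e))"
    by (intro lin_eq_sum; simp)+
  moreover have "(\<Sum>e\<in>?J. lookup v e * lookup (B e) d, \<Sum>e\<in>?J. lookup v' e * lookup (B' e) d) \<in> H" for d
    using v B keys by (intro sum mult) (auto simp: related_def)
  ultimately show ?thesis by (simp add: related_def lookup_sum)
qed

lemma related_unique:
  assumes "ring_relation H" and "single_valued_at_0 H" and "related H v w" and "related H v w'"
  shows "w = w'"
proof (rule poly_mapping_eqI)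
  fix e
  have "(lookup v e - lookup v e, lookup w e - lookup w' e) \<in> H"
    using assms by (intro ring_relation.diff) (auto simp: related_def)
  then have "(0, lookup w e - lookup w' e) \<in> H" by simp
  then have "lookup w e - lookup w' e = 0" using assms(2) unfolding single_valued_at_0_def by blast
  then show "lookup w e = lookup w' e" by simp
qed

lemma related_keys: "single_valued_at_0 H \<Longrightarrow> related H v w \<Longrightarrow> keys w \<subseteq> keys v"
  by (metis in_keys_iff related_def single_valued_at_0_def subsetI)

lemma related_exists:
  assumes sv: "single_valued_at_0 H" and zero: "(0, 0) \<in> H" and "\<And>e. e \<in> keys v \<Longrightarrow> \<exists>y. (lookup v e, y) \<in> H"
  shows "\<exists>w. related H v w"
proof -
  have "\<exists>y. (lookup v e, y) \<in> H" for e
    using assms(3)[of e] zero by (cases "e \<in> keys v") (auto simp: in_keys_iff)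
  then obtain y where y: "\<And>e. (lookup v e, y e) \<in> H" by metis
  have "{e. y e \<noteq> 0} \<subseteq> keys v"
  proof
    fix e assume "e \<in> {e. y e \<noteq> 0}"
    then show "e \<in> keys v" using y[of e] sv by (auto simp: single_valued_at_0_def in_keys_iff)
  qed
  then have "finite {e. y e \<noteq> 0}" using finite_keys finite_subset by blast
  then have "related H v (Abs_poly_mapping y)" using y by (simp add: related_def)
  then show ?thesis ..
qed

lemma related_coord:
  assumes "based_algebra scale mul E i1" and "based_algebra scale mul E i2" and "\<And>k. (i1 k, i2 k) \<in> H"
  shows "related H (based_algebra.coord scale E i1 a) (based_algebra.coord scale E i2 a)"
  using assms by (simp add: related_def based_algebra.lookup_coord)

lemma related_model_mult:
  assumes "ring_relation H" and b: "based_algebra scale mul E i1" "based_algebra scale mul E i2"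
    and "\<And>k. (i1 k, i2 k) \<in> H" and "related H v v'" and "related H w w'"
  shows "related H (based_algebra.model_mult scale mul E i1 v w) (based_algebra.model_mult scale mul E i2 v' w')"
  unfolding based_algebra.model_mult_def[OF b(1)] based_algebra.model_mult_def[OF b(2)]
  using assms by (intro related_lin[where S = UNIV] related_coord) auto

text \<open>
  The matrices \<open>P\<close> and \<open>Q\<close> of an isomorphism and its inverse are specialised to matrices \<open>P'\<close> and \<open>Q'\<close>.
  Being mutually inverse and multiplicative is tested on basis vectors, where it consists of identities
  between vectors built from matrix entries and structure constants; these pass to \<open>P'\<close> and \<open>Q'\<close>. The
  inverse has to be specialised along with \<open>P\<close>, because invertibility of an infinite matrix is not
  visible from the matrix alone.
\<close>

theorem model_isomorphism_transfer:
  fixes i1 :: "'k::field \<Rightarrow> 'f1::field" and i2 :: "'k \<Rightarrow> 'f2::alg_closed_field"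
    and scaleA :: "'k \<Rightarrow> 'a::ab_group_add \<Rightarrow> 'a" and scaleB :: "'k \<Rightarrow> 'b::ab_group_add \<Rightarrow> 'b"
  assumes A1: "based_algebra scaleA mulA EA i1" and B1: "based_algebra scaleB mulB EB i1"
    and A2: "based_algebra scaleA mulA EA i2" and B2: "based_algebra scaleB mulB EB i2"
    and few: "|EA| <o |UNIV :: 'f2 set|" "|EB| <o |UNIV :: 'f2 set|"
    and iso: "algebra_isomorphic (based_algebra.model scaleA mulA EA i1) (based_algebra.model scaleB mulB EB i1)"
  shows "algebra_isomorphic (based_algebra.model scaleA mulA EA i2) (based_algebra.model scaleB mulB EB i2)"
proof -
  interpret A1: based_algebra scaleA mulA EA i1 by (rule A1)
  interpret B1: based_algebra scaleB mulB EB i1 by (rule B1)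
  interpret A2: based_algebra scaleA mulA EA i2 by (rule A2)
  interpret B2: based_algebra scaleB mulB EB i2 by (rule B2)
  interpret two_embeddings i1 i2
    by unfold_locales (rule A1.embedding A2.embedding)+
  obtain h where h: "bij_betw h {v. keys v \<subseteq> EA} {v. keys v \<subseteq> EB}"
    and h_add: "\<And>v w. keys v \<subseteq> EA \<Longrightarrow> keys w \<subseteq> EA \<Longrightarrow> h (v + w) = h v + h w"
    and h_scal: "\<And>c v. keys v \<subseteq> EA \<Longrightarrow> h (scal c v) = scal c (h v)"
    and h_mult: "\<And>v w. keys v \<subseteq> EA \<Longrightarrow> keys w \<subseteq> EA \<Longrightarrow>
      h (A1.model_mult v w) = B1.model_mult (h v) (h w)"
    using iso by (auto simp: algebra_isomorphic_def A1.model_def B1.model_def)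
  define g where "g = inv_into {v. keys v \<subseteq> EA} h"
  have gh: "g (h v) = v" if "keys v \<subseteq> EA" for v
    unfolding g_def using bij_betw_inv_into_left[OF h] that by simp
  have hg: "h (g w) = w" if "keys w \<subseteq> EB" for w
    unfolding g_def using bij_betw_inv_into_right[OF h] that by simp
  have h_keys: "keys (h v) \<subseteq> EB" if "keys v \<subseteq> EA" for v
    using bij_betwE[OF h] that by simp
  have g_keys: "keys (g w) \<subseteq> EA" if "keys w \<subseteq> EB" for w
    using bij_betwE[OF bij_betw_inv_into[OF h]] that by (simp add: g_def)
  have g_add: "g (v + w) = g v + g w" if "keys v \<subseteq> EB" "keys w \<subseteq> EB" for v w
    using gh[of "g v + g w"] that by (simp add: h_add hg g_keys keys_add_le)
  have g_scal: "g (scal c v) = scal c (g v)" if "keys v \<subseteq> EB" for c v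
    using gh[of "scal c (g v)"] that by (simp add: h_scal hg g_keys keys_map_le)

  define P where "P e = h (single e 1)" for e
  define Q where "Q d = g (single d 1)" for d
  have P_keys: "keys (P e) \<subseteq> EB" if "e \<in> EA" for e
    unfolding P_def using that by (intro h_keys) simp
  have Q_keys: "keys (Q d) \<subseteq> EA" if "d \<in> EB" for d
    unfolding Q_def using that by (intro g_keys) simp
  have h_lin: "h v = lin P v" if "keys v \<subseteq> EA" for v
    unfolding P_def by (rule linear_eq_lin[OF h_add h_scal that])
  have g_lin: "g w = lin Q w" if "keys w \<subseteq> EB" for w
    unfolding Q_def by (rule linear_eq_lin[OF g_add g_scal that])
  have QP: "lin Q (P e) = single e 1" if "e \<in> EA" for e
    using g_lin[OF P_keys[OF that]] gh[of "single e 1"] that by (simp add: P_def)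
  have PQ: "lin P (Q d) = single d 1" if "d \<in> EB" for d
    using h_lin[OF Q_keys[OF that]] hg[of "single d 1"] that by (simp add: Q_def)
  have P_mult: "lin P (A1.coord (mulA e e')) = B1.model_mult (P e) (P e')" if "e \<in> EA" "e' \<in> EA" for e e'
    using h_mult[of "single e 1" "single e' 1"] that A1.model_mult_coord[of e e']
    by (simp add: A1.coord_basis A1.keys_coord flip: h_lin P_def)

  \<comment> \<open>All matrix entries at once: only the size of the index set \<open>EA \<times> EB\<close> counts.\<close>
  define S where "S = (\<lambda>(e, d). lookup (P e) d) ` (EA \<times> EB) \<union> (\<lambda>(d, e). lookup (Q d) e) ` (EB \<times> EA)"
  have S_few: "|S| <o |UNIV :: 'f2 set|"
    unfolding S_def using few alg_closed_field_infinite
    by (intro card_of_Un_ordLess_infinite ordLeq_ordLess_trans[OF card_of_image]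
      card_of_Times_ordLess) auto
  obtain H where H: "ring_relation H" "single_valued_at_0 H"
    and K: "\<And>k. (i1 k, i2 k) \<in> H" and dom: "\<And>x. x \<in> S \<Longrightarrow> \<exists>y. (x, y) \<in> H"
    using specialization[OF S_few] by auto
  interpret ring_relation H by (rule H(1))
  have "\<exists>w. related H (P e) w" if "e \<in> EA" for e
    using P_keys[OF that] that by (intro related_exists[OF H(2) zero] dom) (auto simp: S_def)
  then obtain P' where P': "\<And>e. e \<in> EA \<Longrightarrow> related H (P e) (P' e)" by metis
  have "\<exists>w. related H (Q d) w" if "d \<in> EB" for d
    using Q_keys[OF that] that by (intro related_exists[OF H(2) zero] dom) (auto simp: S_def)
  then obtain Q' where Q': "\<And>d. d \<in> EB \<Longrightarrow> related H (Q d) (Q' d)" by metis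
  note unique = related_unique[OF H]
  have P'_keys: "keys (P' e) \<subseteq> EB" if "e \<in> EA" for e
    using related_keys[OF H(2) P'[OF that]] P_keys[OF that] by blast
  have Q'_keys: "keys (Q' d) \<subseteq> EA" if "d \<in> EB" for d
    using related_keys[OF H(2) Q'[OF that]] Q_keys[OF that] by blast
  have QP': "lin Q' (P' e) = single e 1" if "e \<in> EA" for e
  proof (rule unique)
    show "related H (lin Q (P e)) (lin Q' (P' e))"
      by (rule related_lin[OF H(1) P'[OF that] P_keys[OF that] P'_keys[OF that] Q'])
    show "related H (lin Q (P e)) (single e 1)"
      by (simp add: QP that related_single)
  qed
  have PQ': "lin P' (Q' d) = single d 1" if "d \<in> EB" for d
  proof (rule unique)
    show "related H (lin P (Q d)) (lin P' (Q' d))"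
      by (rule related_lin[OF H(1) Q'[OF that] Q_keys[OF that] Q'_keys[OF that] P'])
    show "related H (lin P (Q d)) (single d 1)"
      by (simp add: PQ that related_single)
  qed
  have P'_mult: "lin P' (A2.coord (mulA e e')) = B2.model_mult (P' e) (P' e')" if "e \<in> EA" "e' \<in> EA" for e e'
  proof (rule unique)
    show "related H (lin P (A1.coord (mulA e e'))) (lin P' (A2.coord (mulA e e')))"
      by (rule related_lin[OF H(1) related_coord[OF A1 A2 K] A1.keys_coord A2.keys_coord P'])
    show "related H (lin P (A1.coord (mulA e e'))) (B2.model_mult (P' e) (P' e'))"
      unfolding P_mult[OF that] using that by (intro related_model_mult[OF H(1) B1 B2 K] P')
  qed

  have lin_inverse: "lin C (lin B v) = v"
    if "keys v \<subseteq> T" "\<And>e. e \<in> T \<Longrightarrow> lin C (B e) = single e 1"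
    for v :: "'u \<Rightarrow>\<^sub>0 'f2" and B :: "'u \<Rightarrow> 'v \<Rightarrow>\<^sub>0 'f2" and C T
  proof -
    have "lin C (lin B v) = lin (\<lambda>e. single e 1) v"
      unfolding lin_lin using that by (intro lin_cong) auto
    then show ?thesis by (simp add: lin_single_id)
  qed
  have "bij_betw (lin P') {v. keys v \<subseteq> EA} {v. keys v \<subseteq> EB}"
  proof (rule bij_betw_byWitness[where f' = "lin Q'"])
    show "\<forall>v\<in>{v. keys v \<subseteq> EA}. lin Q' (lin P' v) = v" by (auto intro: lin_inverse QP')
    show "\<forall>v\<in>{v. keys v \<subseteq> EB}. lin P' (lin Q' v) = v" by (auto intro: lin_inverse PQ')
    show "lin P' ` {v. keys v \<subseteq> EA} \<subseteq> {v. keys v \<subseteq> EB}"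
      using keys_lin_subset[of _ P' EB] P'_keys by blast
    show "lin Q' ` {v. keys v \<subseteq> EB} \<subseteq> {v. keys v \<subseteq> EA}"
      using keys_lin_subset[of _ Q' EA] Q'_keys by blast
  qed
  moreover have "lin P' (A2.model_mult v w) = B2.model_mult (lin P' v) (lin P' w)"
    if v: "keys v \<subseteq> EA" and w: "keys w \<subseteq> EA" for v w
  proof -
    have "lin P' (A2.model_mult v w) = lin (\<lambda>e. lin (\<lambda>e'. B2.model_mult (P' e) (P' e')) w) v"
      unfolding A2.model_mult_def lin_lin using v w by (intro lin_cong P'_mult) auto
    also have "\<dots> = B2.model_mult (lin P' v) (lin P' w)"
      unfolding B2.model_mult_def lin_lin by (intro lin_cong) (rule lin_swap)
    finally show ?thesis .
  qed
  ultimately show ?thesis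
    by (auto simp: algebra_isomorphic_def A2.model_def B2.model_def lin_add lin_scal)
qed

text \<open>
  The bound on the dimension passes from \<open>'k\<close> to \<open>'f2\<close> because field embeddings are injective.
  Exchanging the two fields gives the converse implication.
\<close>

lemma base_change_isomorphism_transfer:
  fixes i1 :: "'k::field \<Rightarrow> 'f1::field"
    and i2 :: "'k \<Rightarrow> 'f2::alg_closed_field"
    and scaleA :: "'k \<Rightarrow> 'a::ab_group_add \<Rightarrow> 'a" and multA :: "'a \<Rightarrow> 'a \<Rightarrow> 'a"
    and scaleB :: "'k \<Rightarrow> 'b::ab_group_add \<Rightarrow> 'b" and multB :: "'b \<Rightarrow> 'b \<Rightarrow> 'b"
    and \<omega> :: "'w rel"
  assumes i1: "field_embedding i1" and i2: "field_embedding i2"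
    and A: "nonassoc_algebra scaleA multA" and B: "nonassoc_algebra scaleB multB"
    and dimA: "has_dimension scaleA \<omega>" and dimB: "has_dimension scaleB \<omega>"
    and few: "\<omega> <o |UNIV :: 'k set|"
    and iso: "algebra_isomorphic (base_change scaleA multA i1) (base_change scaleB multB i1)"
  shows "algebra_isomorphic (base_change scaleA multA i2) (base_change scaleB multB i2)"
proof -
  obtain EA where EA: "\<not> module.dependent scaleA EA" "module.span scaleA EA = UNIV" "|EA| =o \<omega>"
    using dimA by (auto simp: has_dimension_def)
  obtain EB where EB: "\<not> module.dependent scaleB EB" "module.span scaleB EB = UNIV" "|EB| =o \<omega>"
    using dimB by (auto simp: has_dimension_def)
  have A1: "based_algebra scaleA multA EA i1" and A2: "based_algebra scaleA multA EA i2"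
    unfolding based_algebra_def based_algebra_axioms_def using A EA i1 i2 by simp_all
  have B1: "based_algebra scaleB multB EB i1" and B2: "based_algebra scaleB multB EB i2"
    unfolding based_algebra_def based_algebra_axioms_def using B EB i1 i2 by simp_all
  have "inj i2"
  proof (rule injI)
    fix x y assume "i2 x = i2 y"
    then have "i2 (x - y) = 0" by (simp add: field_embedding_diff[OF i2])
    then show "x = y" by (simp add: field_embedding_eq_0_iff[OF i2])
  qed
  then have "|UNIV :: 'k set| \<le>o |UNIV :: 'f2 set|"
    by (meson card_of_ordLeq subset_UNIV)
  with few have "\<omega> <o |UNIV :: 'f2 set|" by (rule ordLess_ordLeq_trans)
  then have "|EA| <o |UNIV :: 'f2 set|" "|EB| <o |UNIV :: 'f2 set|"
    using EA(3) EB(3) ordIso_ordLess_trans by blast+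
  moreover have "algebra_isomorphic (based_algebra.model scaleA multA EA i1) (based_algebra.model scaleB multB EB i1)"
    using based_algebra.model_isomorphic_base_change[OF A1] iso
      algebra_isomorphic_sym[OF based_algebra.model_isomorphic_base_change[OF B1] based_algebra.closed_model[OF B1]]
    by (meson algebra_isomorphic_trans)
  ultimately have "algebra_isomorphic (based_algebra.model scaleA multA EA i2) (based_algebra.model scaleB multB EB i2)"
    by (intro model_isomorphism_transfer[OF A1 B1 A2 B2])
  then show ?thesis
    using based_algebra.model_isomorphic_base_change[OF B2]
      algebra_isomorphic_sym[OF based_algebra.model_isomorphic_base_change[OF A2] based_algebra.closed_model[OF A2]]
    by (meson algebra_isomorphic_trans)
qed

theorem corollary5p4:
  fixes i1 :: "'k::field \<Rightarrow> 'f1::alg_closed_field"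
    and i2 :: "'k \<Rightarrow> 'f2::alg_closed_field"
    and scaleA :: "'k \<Rightarrow> 'a::ab_group_add \<Rightarrow> 'a" and multA :: "'a \<Rightarrow> 'a \<Rightarrow> 'a"
    and scaleB :: "'k \<Rightarrow> 'b::ab_group_add \<Rightarrow> 'b" and multB :: "'b \<Rightarrow> 'b \<Rightarrow> 'b"
    and \<omega> :: "'w rel"
  assumes "field_embedding i1" and "field_embedding i2"
    and "nonassoc_algebra scaleA multA" and "nonassoc_algebra scaleB multB"
    and "has_dimension scaleA \<omega>" and "has_dimension scaleB \<omega>"
    and "\<omega> <o |UNIV :: 'k set|"
  shows "algebra_isomorphic (base_change scaleA multA i1) (base_change scaleB multB i1) \<longleftrightarrow>
         algebra_isomorphic (base_change scaleA multA i2) (base_change scaleB multB i2)"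
  using base_change_isomorphism_transfer[OF assms]
    base_change_isomorphism_transfer[OF assms(2,1,3-)] by blast

end
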